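(* Let $p,q$ be positive integers and suppose that $(X,Y)\sim\mathcal N_{p+q}(\mu,\Sigma)$, where $X\in\mathbb{R}^p$, $Y\in\mathbb{R}^q$ and $$\Sigma=\begin{pmatrix}\Sigma_X&\Sigma_{XY}\\ \Sigma_{YX}&\Sigma_Y\end{pmatrix}$$ with $\Sigma_X\in\mathbb{R}^{p\times p}$ and $\Sigma_Y\in\mathbb{R}^{q\times q}$ nonsingular and $\Sigma_{XY}\in\mathbb{R}^{p\times q}$. Then $$\widetilde{\mathcal V}^2(X,Y)=4\pi\,\frac{c_{p-1}}{c_p}\,\frac{c_{q-1}}{c_q}\sum_{k=1}^\infty\frac{2^{2k}-2}{k!\,2^{2k}}\,\frac{(\frac12)_k\,(-\frac12)_k\,(-\frac12)_k}{(\frac12p)_k\,(\frac12q)_k}\,C_{(k)}(\Lambda),$$ where $$\Lambda=\Sigma_Y^{-1/2}\Sigma_{YX}\Sigma_X^{-1}\Sigma_{XY}\Sigma_Y^{-1/2}\in\mathbb{R}^{q\times q}.$$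
   Context: $|\cdot|_p$ and $\langle\cdot,\cdot\rangle_p$ denote the Euclidean norm and scalar product on $\mathbb{R}^p$; $c_p=\pi^{(p+1)/2}/\Gamma((p+1)/2)$ (for integers $p\ge0$); $(\alpha)_k=\alpha(\alpha+1)\cdots(\alpha+k-1)$ is the rising factorial, with $(\alpha)_0=1$. For jointly distributed random vectors $X\in\mathbb{R}^p$, $Y\in\mathbb{R}^q$ let $f_{X,Y}(s,t)=\mathbb{E}\exp[\mathrm{i}\langle s,X\rangle_p+\mathrm{i}\langle t,Y\rangle_q]$, $f_X(s)=f_{X,Y}(s,0)$, $f_Y(t)=f_{X,Y}(0,t)$. The distance covariance $\mathcal V(X,Y)\ge0$ is defined by $$\mathcal V^2(X,Y)=\frac{1}{c_pc_q}\int_{\mathbb{R}^{p+q}}\frac{|f_{X,Y}(s,t)-f_X(s)f_Y(t)|^2}{|s|_p^{p+1}|t|_q^{q+1}}\,ds\,dt .$$ For $X,Y$ with finite second moments and nonsingular covariance matrices $\Sigma_X,\Sigma_Y$, the affinely invariant distance covariance $\widetilde{\mathcal V}(X,Y)\ge0$ is defined by $\widetilde{\mathcal V}^2(X,Y)=\mathcal V^2(\Sigma_X^{-1/2}X,\Sigma_Y^{-1/2}Y)$, where inverse square roots are those of positive definite matrices. $\mathcal N_{p+q}(\mu,\Sigma)$ is the multivariate normal distribution with mean $\mu\in\mathbb{R}^{p+q}$ and covariance matrix $\Sigma$ (possibly singular); $\Sigma_{YX}=\Sigma_{XY}'$, where $'$ denotes transpose. $C_{(k)}$ is the zonal polynomial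 of the one-part partition $(k)$; for a symmetric matrix $\Lambda\in\mathbb{R}^{q\times q}$ with eigenvalues $\lambda_1,\ldots,\lambda_q$ it is given by $$C_{(k)}(\Lambda)=\frac{k!}{(\frac12)_k}\sum_{i_1+\cdots+i_q=k}\ \prod_{j=1}^q\frac{(\frac12)_{i_j}\lambda_j^{i_j}}{i_j!},$$ the sum being over all nonnegative integers $i_1,\ldots,i_q$ with $i_1+\cdots+i_q=k$. *)

theory Defs
  imports "HOL-Probability.Probability"
begin

definition dcov_const :: "nat \<Rightarrow> real" where
  "dcov_const p = pi powr ((real p + 1) / 2) / Gamma ((real p + 1) / 2)"


subsection \<open>Matrices\<close>

definition positive_definite :: "real^'n^'n \<Rightarrow> bool" where
  "positive_definite A \<longleftrightarrow> transpose A = A \<and> (\<forall>x. x \<noteq> 0 \<longrightarrow> x \<bullet> (A *v x) > 0)"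

text \<open>Meaningful for positive definite \<open>A\<close> only, where existence and uniqueness hold.\<close>

definition inv_sqrt :: "real^'n^'n \<Rightarrow> real^'n^'n" where
  "inv_sqrt A = (THE B. positive_definite B \<and> B ** B = matrix_inv A)"

definition block_matrix ::
  "real^'p^'p \<Rightarrow> real^'q^'p \<Rightarrow> real^'p^'q \<Rightarrow> real^'q^'q \<Rightarrow> real^('p + 'q)^('p + 'q)" where
  "block_matrix A B C D = (\<chi> i j. case i of
     Inl a \<Rightarrow> (case j of Inl b \<Rightarrow> A $ a $ b | Inr b \<Rightarrow> B $ a $ b)
   | Inr a \<Rightarrow> (case j of Inl b \<Rightarrow> C $ a $ b | Inr b \<Rightarrow> D $ a $ b))"

definition join_vec :: "real^'p \<Rightarrow> real^'q \<Rightarrow> real^('p + 'q)" where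
  "join_vec x y = (\<chi> i. case i of Inl a \<Rightarrow> x $ a | Inr b \<Rightarrow> y $ b)"

text \<open>
  The eigenvalues of a matrix with real characteristic roots, repeated according to algebraic
  multiplicity.  The enumeration by the index type is arbitrary; it is only used below in an
  expression that is symmetric in the eigenvalues.  Note that \<open>mat x\<close> is \<open>x\<close> times the identity.
\<close>

definition eigvals :: "real^'n^'n \<Rightarrow> 'n \<Rightarrow> real" where
  "eigvals A = (SOME l. \<forall>x. det (mat x - A) = (\<Prod>j\<in>UNIV. x - l j))"

text \<open>The zonal polynomial of the one-part partition \<open>(k)\<close>, for symmetric matrices.\<close>

definition zonal :: "nat \<Rightarrow> real^'n^'n \<Rightarrow> real" where
  "zonal k A = fact k / pochhammer (1/2) k *
     (\<Sum>i\<in>{i :: 'n \<Rightarrow> nat. (\<Sum>j\<in>UNIV. i j) = k}.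
        \<Prod>j\<in>UNIV. pochhammer (1/2) (i j) * eigvals A j ^ i j / fact (i j))"


subsection \<open>Multivariate normal random vectors\<close>

definition mean_vec :: "'a measure \<Rightarrow> ('a \<Rightarrow> real^'n) \<Rightarrow> real^'n" where
  "mean_vec M Z = (\<chi> i. LINT w|M. Z w $ i)"

definition cov_matrix :: "'a measure \<Rightarrow> ('a \<Rightarrow> real^'n) \<Rightarrow> real^'n^'n" where
  "cov_matrix M Z =
     (\<chi> i j. LINT w|M. (Z w $ i - mean_vec M Z $ i) * (Z w $ j - mean_vec M Z $ j))"

text \<open>
  A random vector is normal if all its linear functionals are univariate normal, where point masses
  count as normal distributions.  This covers singular covariance matrices.
\<close>

definition multivariate_normal ::
  "'a measure \<Rightarrow> ('a \<Rightarrow> real^'n) \<Rightarrow> real^'n \<Rightarrow> real^'n^'n \<Rightarrow> bool" where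
  "multivariate_normal M Z \<mu> S \<longleftrightarrow>
     Z \<in> borel_measurable M \<and>
     (\<forall>u. (\<exists>m. AE w in M. u \<bullet> Z w = m) \<or>
          (\<exists>m \<sigma>. \<sigma> > 0 \<and> distributed M lborel (\<lambda>w. u \<bullet> Z w) (normal_density m \<sigma>))) \<and>
     mean_vec M Z = \<mu> \<and> cov_matrix M Z = S"


subsection \<open>Distance covariance\<close>

definition joint_char ::
  "'a measure \<Rightarrow> ('a \<Rightarrow> real^'p) \<Rightarrow> ('a \<Rightarrow> real^'q) \<Rightarrow> real^'p \<Rightarrow> real^'q \<Rightarrow> complex" where
  "joint_char M X Y s t =
     (CLINT w|M. exp (\<i> * complex_of_real (s \<bullet> X w) + \<i> * complex_of_real (t \<bullet> Y w)))"

definition dcov_integrand ::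
  "'a measure \<Rightarrow> ('a \<Rightarrow> real^'p) \<Rightarrow> ('a \<Rightarrow> real^'q) \<Rightarrow> (real^'p) \<times> (real^'q) \<Rightarrow> real" where
  "dcov_integrand M X Y = (\<lambda>(s, t).
     (cmod (joint_char M X Y s t - joint_char M X Y s 0 * joint_char M X Y 0 t))\<^sup>2
       / (norm s ^ (CARD('p) + 1) * norm t ^ (CARD('q) + 1)))"

text \<open>
  The Bochner integral is \<open>0\<close> for a non-integrable integrand, so the value is meaningful only
  together with integrability of \<^const>\<open>dcov_integrand\<close>.
\<close>

definition dcov :: "'a measure \<Rightarrow> ('a \<Rightarrow> real^'p) \<Rightarrow> ('a \<Rightarrow> real^'q) \<Rightarrow> real" where
  "dcov M X Y = sqrt (1 / (dcov_const CARD('p) * dcov_const CARD('q)) *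
     (LINT z|lborel. dcov_integrand M X Y z))"

definition standardize :: "'a measure \<Rightarrow> ('a \<Rightarrow> real^'n) \<Rightarrow> 'a \<Rightarrow> real^'n" where
  "standardize M X = (\<lambda>w. inv_sqrt (cov_matrix M X) *v X w)"

definition affine_dcov :: "'a measure \<Rightarrow> ('a \<Rightarrow> real^'p) \<Rightarrow> ('a \<Rightarrow> real^'q) \<Rightarrow> real" where
  "affine_dcov M X Y = dcov M (standardize M X) (standardize M Y)"

end

theory Submission
  imports Defs
begin

text \<open>
  After standardization both marginal covariance matrices are the identity, the cross covariance is
  \<open>A = \<Sigma>\<^sub>X\<^sup>-\<^sup>1\<^sup>/\<^sup>2 \<Sigma>\<^sub>X\<^sub>Y \<Sigma>\<^sub>Y\<^sup>-\<^sup>1\<^sup>/\<^sup>2\<close>, and \<open>\<Lambda> = A\<^sup>T A\<close>.  The characteristic functions are explicit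
  (\<open>multivariate_normal_char\<close>, \<open>dcov_integrand_standardized_normal\<close>), and the integral to be
  computed is
  \<open>\<integral>\<integral> exp (- |s|\<^sup>2 - |t|\<^sup>2) (1 - exp (- s \<bullet> A t))\<^sup>2 / (|s|\<^sup>p\<^sup>+\<^sup>1 |t|\<^sup>q\<^sup>+\<^sup>1) ds dt\<close>.

  Averaging over \<open>s\<close> and \<open>- s\<close> turns the square into the power series
  \<open>\<Sum>k\<ge>1. (2\<^sup>2\<^sup>k - 2) / (2k)! (s \<bullet> A t)\<^sup>2\<^sup>k\<close>, all of whose terms are nonnegative, so Tonelli applies termwise.
  By rotation invariance, the integral of the \<open>k\<close>-th term over \<open>s\<close> is a constant times
  \<open>|A t|\<^sup>2\<^sup>k = (t \<bullet> \<Lambda> t)\<^sup>k\<close> (\<open>nn_integral_radial_weight_linear_form\<close>).  For the integral over \<open>t\<close>, the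
  matrix \<open>\<Lambda>\<close> is diagonalized and the \<open>k\<close>-th power is expanded by the multinomial theorem; the monomial
  \<open>\<Prod>j. (t $ j)\<^sup>2\<^sup>i\<^sup>(\<^sup>j\<^sup>)\<close> has a moment proportional to \<open>\<Prod>j. (1/2)\<^sub>i\<^sub>(\<^sub>j\<^sub>)\<close>, and the resulting sum is by
  definition a multiple of the zonal polynomial (\<open>nn_integral_radial_weight_quadratic_form\<close>).  The
  moments come from writing \<open>|t|\<^sup>-\<^sup>q\<^sup>-\<^sup>1\<close> as a Gamma integral, which makes the weight a mixture of
  Gaussians (\<open>nn_integral_radial_weight_monomial\<close>).

  All of this takes place in the nonnegative extended reals, so integrability and summability are the
  same question.  Because the joint covariance matrix is positive semidefinite, the eigenvalues of \<open>\<Lambda>\<close>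
  lie in \<open>[0, 1]\<close>.  Hence the zonal polynomials are bounded by their values at the identity, and the
  series is dominated by the telescoping binomial series of \<open>(1 - x)\<^sup>1\<^sup>/\<^sup>2\<close> at \<open>x = 1\<close>
  (\<open>zonal_nonneg_le\<close>, \<open>dcov_term_bounds\<close>).

  The spectral theorem is needed in three places: for the inverse square root, which is
  defined by a unique description; for the eigenvalues of \<open>\<Lambda>\<close>, which are defined through the
  characteristic polynomial; and for the rotation in the integral over \<open>t\<close>.
\<close>

section \<open>Symmetric matrices\<close>

definition diagonal_matrix :: "('n \<Rightarrow> real) \<Rightarrow> real^'n^'n" where
  "diagonal_matrix d = (\<chi> i j. if i = j then d i else 0)"

lemma diagonal_matrix_vec_nth [simp]: "(diagonal_matrix d *v x) $ i = d i * x $ i"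
  by (simp add: diagonal_matrix_def matrix_vector_mult_def if_distrib[of "\<lambda>y. y * _"] cong: if_cong)

lemma diagonal_matrix_mult [simp]:
  "diagonal_matrix d ** diagonal_matrix e = diagonal_matrix (\<lambda>i. d i * e i)"
  by (simp add: matrix_eq matrix_vector_mul_assoc[symmetric] vec_eq_iff)

lemma transpose_diagonal_matrix [simp]: "transpose (diagonal_matrix d) = diagonal_matrix d"
  by (simp add: diagonal_matrix_def transpose_def vec_eq_iff)

lemma mat_eq_diagonal_matrix: "mat x = diagonal_matrix (\<lambda>_. x)"
  by (simp add: diagonal_matrix_def mat_def)

text \<open>
  Cauchy--Schwarz for a positive semidefinite form in its degenerate case: if the form
  vanishes at \<open>v\<close> but \<open>w \<bullet> A v\<close> does not, moving from \<open>v\<close> a short way along \<open>w\<close> or \<open>- w\<close> makes the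
  form negative.
\<close>

lemma nonneg_form_zero_imp_polar_zero:
  fixes A :: "real^'n^'n"
  assumes sym: "transpose A = A" and S: "subspace S"
    and nonneg: "\<And>x. x \<in> S \<Longrightarrow> x \<bullet> (A *v x) \<ge> 0"
    and v: "v \<in> S" "v \<bullet> (A *v v) = 0" and w: "w \<in> S"
  shows "w \<bullet> (A *v v) = 0"
proof (rule ccontr)
  define b where "b = w \<bullet> (A *v v)"
  define c where "c = w \<bullet> (A *v w)"
  assume "w \<bullet> (A *v v) \<noteq> 0"
  then have b: "b \<noteq> 0" by (simp add: b_def)
  have b': "v \<bullet> (A *v w) = b"
    unfolding b_def by (metis dot_lmul_matrix inner_commute sym transpose_matrix_vector)
  have c: "c \<ge> 0" using nonneg w by (simp add: c_def)
  \<comment> \<open>The quadratic \<open>2 e b + e\<^sup>2 c\<close> has its minimum at \<open>- b / c\<close>; the \<open>+ 1\<close> covers \<open>c = 0\<close>.\<close>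
  define e where "e = - b / (c + 1)"
  have "v + e *\<^sub>R w \<in> S"
    using S v w by (simp add: subspace_add subspace_mul)
  then have "0 \<le> (v + e *\<^sub>R w) \<bullet> (A *v (v + e *\<^sub>R w))"
    by (rule nonneg)
  also have "\<dots> = 2 * e * b + e\<^sup>2 * c"
    using v b' by (simp add: algebra_simps matrix_vector_right_distrib matrix_vector_mult_scaleR
        inner_add_left inner_add_right power2_eq_square b_def c_def)
  also have "e\<^sup>2 * c \<le> e * (e * (c + 1))"
    by (simp add: power2_eq_square algebra_simps)
  also have "e * (c + 1) = - b" using c by (simp add: e_def)
  also have "2 * e * b + e * - b = - (b\<^sup>2 / (c + 1))"
    by (simp add: e_def power2_eq_square)
  also have "\<dots> < 0" using b c by simp
  finally show False by simp
qed

text \<open>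
  A maximizer \<open>v\<close> of the Rayleigh quotient on \<open>S\<close>, with maximum \<open>l\<close>, makes the form of \<open>l - A\<close>
  nonnegative on \<open>S\<close> and zero at \<open>v\<close>.  By the previous lemma \<open>l v - A v\<close>, which lies in \<open>S\<close>, is then
  orthogonal to itself.
\<close>

lemma symmetric_matrix_maximum_eigenvector:
  fixes A :: "real^'n^'n"
  assumes sym: "transpose A = A" and S: "subspace S"
    and inv: "\<And>x. x \<in> S \<Longrightarrow> A *v x \<in> S" and "S \<noteq> {0}"
  obtains v l where "v \<in> S" "norm v = 1" "A *v v = l *\<^sub>R v"
proof -
  let ?K = "S \<inter> sphere 0 1"
  obtain x where x: "x \<in> S" "x \<noteq> 0"
    using \<open>S \<noteq> {0}\<close> subspace_0[OF S] by auto
  have "(1 / norm x) *\<^sub>R x \<in> ?K"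
    using x S by (simp add: subspace_mul)
  then have ne: "?K \<noteq> {}" by blast
  have "compact ?K"
    by (simp add: closed_Int_compact closed_subspace S)
  moreover have "continuous_on ?K (\<lambda>x. x \<bullet> (A *v x))"
    by (intro continuous_intros)
  ultimately obtain v where v: "v \<in> ?K" and max: "\<And>y. y \<in> ?K \<Longrightarrow> y \<bullet> (A *v y) \<le> v \<bullet> (A *v v)"
    using continuous_attains_sup ne by meson
  define l where "l = v \<bullet> (A *v v)"
  define L where "L = mat l - A"
  have L: "L *v x = l *\<^sub>R x - A *v x" for x
    by (simp add: L_def matrix_vector_mult_diff_rdistrib mat_eq_diagonal_matrix vec_eq_iff)
  have symL: "transpose L = L"
    using sym by (simp add: L_def vec_eq_iff transpose_def mat_def)
  have nonneg: "x \<bullet> (L *v x) \<ge> 0" if "x \<in> S" for x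
  proof (cases "x = 0")
    case False
    define y where "y = (1 / norm x) *\<^sub>R x"
    have "y \<in> ?K" using that False S by (simp add: y_def subspace_mul)
    then have "y \<bullet> (A *v y) \<le> l" using max l_def by blast
    then have "x \<bullet> (A *v x) \<le> l * (norm x)\<^sup>2"
      using False by (simp add: y_def matrix_vector_mult_scaleR field_simps power2_eq_square)
    then show ?thesis
      by (simp add: L inner_diff_right power2_norm_eq_inner)
  qed simp
  have vv: "v \<in> S" "norm v = 1" using v by auto
  then have v0: "v \<bullet> (L *v v) = 0"
    by (simp add: L inner_diff_right l_def norm_eq_1)
  have "L *v v \<in> S"
    using vv S inv by (simp add: L subspace_diff subspace_mul)
  then have "(L *v v) \<bullet> (L *v v) = 0"
    using nonneg_form_zero_imp_polar_zero[OF symL S nonneg vv(1) v0] by blast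
  then have "A *v v = l *\<^sub>R v" by (simp add: L)
  with vv that show thesis by blast
qed

text \<open>
  One eigenvector is split off at a time: by symmetry its orthogonal complement in \<open>S\<close> is again
  invariant.
\<close>

lemma symmetric_matrix_orthonormal_eigenvectors:
  fixes A :: "real^'n^'n"
  assumes sym: "transpose A = A" and "subspace S" and "\<And>x. x \<in> S \<Longrightarrow> A *v x \<in> S"
  shows "\<exists>B\<subseteq>S. pairwise orthogonal B \<and> span B = S \<and>
           (\<forall>v\<in>B. norm v = 1 \<and> (\<exists>l. A *v v = l *\<^sub>R v))"
  using assms(2,3)
proof (induction "dim S" arbitrary: S rule: less_induct)
  case less
  show ?case
  proof (cases "S = {0}")
    case True
    then show ?thesis by (intro exI[of _ "{}"]) auto
  next
    case False
    obtain v l where v: "v \<in> S" "norm v = 1" "A *v v = l *\<^sub>R v"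
      using symmetric_matrix_maximum_eigenvector[OF sym less.prems(1) less.prems(2) False] by metis
    define T where "T = S \<inter> {w. orthogonal v w}"
    have T: "subspace T"
      unfolding T_def by (intro subspace_inter less.prems subspace_orthogonal_to_vector)
    have invT: "A *v x \<in> T" if "x \<in> T" for x
    proof -
      have "v \<bullet> (A *v x) = (A *v v) \<bullet> x"
        by (metis dot_lmul_matrix sym transpose_matrix_vector)
      also have "\<dots> = 0"
        using that by (simp add: v T_def orthogonal_def)
      finally show ?thesis
        using that less.prems(2) by (simp add: T_def orthogonal_def)
    qed
    have "v \<notin> T" using v by (auto simp: T_def orthogonal_def)
    then have "T \<subset> S" using v T_def by blast
    then have "dim T < dim S"
      by (metis T dim_psubset less.prems(1) span_eq_iff)
    from less.hyps[OF this T invT] obtain B where B: "B \<subseteq> T" "pairwise orthogonal B" "span B = T"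
      "\<forall>v\<in>B. norm v = 1 \<and> (\<exists>l. A *v v = l *\<^sub>R v)"
      by blast
    have "S \<subseteq> span (insert v B)"
    proof
      fix x assume x: "x \<in> S"
      have "x - (v \<bullet> x) *\<^sub>R v \<in> T"
        using x v less.prems by (simp add: T_def orthogonal_def subspace_diff subspace_mul inner_diff_right norm_eq_1)
      then show "x \<in> span (insert v B)"
        unfolding span_insert using B by blast
    qed
    moreover have "span (insert v B) \<subseteq> S"
      using B v less.prems T_def by (intro span_minimal) auto
    moreover have "pairwise orthogonal (insert v B)"
      using B by (auto simp: pairwise_insert T_def orthogonal_commute)
    ultimately show ?thesis
      using B v T_def by (intro exI[of _ "insert v B"]) auto
  qed
qed

theorem symmetric_matrix_diagonalization:
  fixes A :: "real^'n^'n"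
  assumes sym: "transpose A = A"
  obtains Q d where "orthogonal_matrix Q" "A = Q ** diagonal_matrix d ** transpose Q"
proof -
  obtain B where B: "pairwise orthogonal B" "span B = (UNIV :: (real^'n) set)"
    "\<forall>v\<in>B. norm v = 1 \<and> (\<exists>l. A *v v = l *\<^sub>R v)"
    using symmetric_matrix_orthonormal_eigenvectors[OF sym subspace_UNIV] by auto
  have ind: "independent B"
    using B by (intro pairwise_orthogonal_independent) auto
  then have "finite B" by (rule independent_imp_finite)
  have "card B = dim (UNIV :: (real^'n) set)"
    by (rule dim_eq_card[symmetric]) (use B ind in auto)
  also have "dim (UNIV :: (real^'n) set) = CARD('n)" by simp
  finally have "card (UNIV :: 'n set) = card B" ..
  then obtain f where f: "bij_betw f (UNIV :: 'n set) B"
    using finite_same_card_bij[of "UNIV :: 'n set" B] \<open>finite B\<close> by auto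
  have fB: "f j \<in> B" for j using f by (auto simp: bij_betw_def)
  obtain d where d: "\<And>j. A *v f j = d j *\<^sub>R f j"
  proof -
    have "\<forall>j. \<exists>l. A *v f j = l *\<^sub>R f j" using B(3) fB by blast
    then have "\<exists>d. \<forall>j. A *v f j = d j *\<^sub>R f j" by (rule choice)
    then show thesis using that by blast
  qed
  define Q :: "real^'n^'n" where "Q = (\<chi> i j. f j $ i)"
  have col: "column j Q = f j" for j by (simp add: Q_def column_def vec_eq_iff)
  have "i \<noteq> j \<Longrightarrow> f i \<noteq> f j" for i j
    using f by (auto simp: bij_betw_def inj_on_def)
  then have Q: "orthogonal_matrix Q"
    unfolding orthogonal_matrix_orthonormal_columns col
    using B fB by (auto simp: pairwise_def)
  have "(A ** Q) $ i $ j = (Q ** diagonal_matrix d) $ i $ j" for i j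
  proof -
    have "(A ** Q) $ i $ j = (A *v f j) $ i"
      by (simp add: matrix_matrix_mult_def matrix_vector_mult_def Q_def)
    also have "\<dots> = (Q ** diagonal_matrix d) $ i $ j"
      by (simp add: d Q_def matrix_matrix_mult_def diagonal_matrix_def if_distrib sum.delta cong: if_cong)
    finally show ?thesis .
  qed
  then have "A ** Q = Q ** diagonal_matrix d" by (simp add: vec_eq_iff)
  then have "A ** (Q ** transpose Q) = Q ** diagonal_matrix d ** transpose Q"
    by (simp add: matrix_mul_assoc)
  then have "A = Q ** diagonal_matrix d ** transpose Q"
    using Q by (simp add: orthogonal_matrix_def)
  with Q that show thesis by blast
qed

lemma diagonalized_quadratic_form:
  fixes Q :: "real^'n^'n"
  shows "x \<bullet> ((Q ** diagonal_matrix d ** transpose Q) *v x) = (\<Sum>j\<in>UNIV. d j * ((transpose Q *v x) $ j)\<^sup>2)"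
proof -
  have "x \<bullet> ((Q ** diagonal_matrix d ** transpose Q) *v x) =
    (transpose Q *v x) \<bullet> (diagonal_matrix d *v (transpose Q *v x))"
    by (simp add: matrix_vector_mul_assoc[symmetric] dot_lmul_matrix[symmetric] transpose_matrix_vector)
  then show ?thesis
    by (simp add: inner_vec_def power2_eq_square algebra_simps)
qed

lemma orthogonal_conjugate_mult:
  fixes Q :: "real^'n^'n"
  assumes "orthogonal_matrix Q"
  shows "(Q ** D ** transpose Q) ** (Q ** E ** transpose Q) = Q ** (D ** E) ** transpose Q"
proof -
  have "(Q ** D ** transpose Q) ** (Q ** E ** transpose Q) = Q ** D ** (transpose Q ** Q) ** E ** transpose Q"
    by (simp add: matrix_mul_assoc)
  also have "transpose Q ** Q = mat 1" using assms by (simp add: orthogonal_matrix_def)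
  finally show ?thesis by (simp add: matrix_mul_assoc)
qed

lemma transpose_orthogonal_conjugate:
  fixes Q :: "real^'n^'n"
  shows "transpose (Q ** diagonal_matrix d ** transpose Q) = Q ** diagonal_matrix d ** transpose Q"
  by (simp add: matrix_transpose_mul matrix_mul_assoc)

lemma diagonalized_eigenvector:
  fixes Q :: "real^'n^'n"
  assumes Q: "orthogonal_matrix Q"
  shows "(Q ** diagonal_matrix d ** transpose Q) *v column j Q = d j *\<^sub>R column j Q"
    and "transpose Q *v column j Q = axis j 1"
proof -
  have "Q *v axis j 1 = column j Q" by (simp add: matrix_vector_mult_basis)
  then have "transpose Q *v column j Q = (transpose Q ** Q) *v axis j 1"
    by (simp add: matrix_vector_mul_assoc[symmetric])
  then show *: "transpose Q *v column j Q = axis j 1"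
    using Q by (simp add: orthogonal_matrix_def)
  have "diagonal_matrix d *v axis j 1 = d j *\<^sub>R axis j 1"
    by (simp add: vec_eq_iff axis_def)
  then show "(Q ** diagonal_matrix d ** transpose Q) *v column j Q = d j *\<^sub>R column j Q"
    by (simp add: matrix_vector_mul_assoc[symmetric] * matrix_vector_mult_scaleR
        del: transpose_matrix_vector matrix_vector_mult_basis)
      (simp add: matrix_vector_mult_basis)
qed

lemma positive_definite_diagonalized_iff:
  fixes Q :: "real^'n^'n"
  assumes Q: "orthogonal_matrix Q"
  shows "positive_definite (Q ** diagonal_matrix d ** transpose Q) \<longleftrightarrow> (\<forall>j. d j > 0)"
proof
  assume P: "positive_definite (Q ** diagonal_matrix d ** transpose Q)"
  show "\<forall>j. d j > 0"
  proof
    fix j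
    have n: "norm (column j Q) = 1" using Q by (simp add: orthogonal_matrix_orthonormal_columns)
    then have "column j Q \<noteq> 0" by force
    then have "column j Q \<bullet> ((Q ** diagonal_matrix d ** transpose Q) *v column j Q) > 0"
      using P by (simp add: positive_definite_def)
    then show "d j > 0"
      using n by (simp add: diagonalized_eigenvector[OF Q] norm_eq_1)
  qed
next
  assume d: "\<forall>j. d j > 0"
  show "positive_definite (Q ** diagonal_matrix d ** transpose Q)"
    unfolding positive_definite_def
  proof (intro conjI allI impI)
    fix x :: "real^'n" assume "x \<noteq> 0"
    then have "transpose Q *v x \<noteq> 0"
      using Q by (metis matrix_vector_mul_assoc matrix_vector_mul_lid matrix_vector_mult_0_right orthogonal_matrix_def)
    then obtain j where "(transpose Q *v x) $ j \<noteq> 0" by (auto simp: vec_eq_iff)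
    then show "0 < x \<bullet> ((Q ** diagonal_matrix d ** transpose Q) *v x)"
      unfolding diagonalized_quadratic_form using d
      by (intro sum_pos2[of _ j]) (auto intro!: mult_pos_pos simp: less_imp_le)
  qed (simp add: transpose_orthogonal_conjugate)
qed

text \<open>
  With \<open>D = B - C\<close> the hypothesis reads \<open>B D + D C = 0\<close>.  Evaluating this at a unit eigenvector \<open>v\<close> of
  \<open>D\<close> with eigenvalue \<open>l\<close> gives \<open>l (v \<bullet> B v + v \<bullet> C v) = 0\<close>, so that every eigenvalue of \<open>D\<close> vanishes.
\<close>

lemma positive_definite_square_unique:
  fixes B C :: "real^'n^'n"
  assumes B: "positive_definite B" and C: "positive_definite C" and eq: "B ** B = C ** C"
  shows "B = C"
proof -
  define D where "D = B - C"
  have sym: "transpose D = D"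
    using B C by (simp add: D_def positive_definite_def vec_eq_iff transpose_def)
  have Dx: "D *v x = B *v x - C *v x" for x
    by (simp add: D_def matrix_vector_mult_diff_rdistrib)
  have zero: "B *v (D *v x) + D *v (C *v x) = 0" for x
  proof -
    have "B *v (D *v x) + D *v (C *v x) = (B ** B) *v x - (C ** C) *v x"
      unfolding Dx by (simp add: matrix_vector_mult_diff_distrib matrix_vector_mul_assoc[symmetric])
    with eq show ?thesis by simp
  qed
  obtain Q d where Q: "orthogonal_matrix Q" and DQ: "D = Q ** diagonal_matrix d ** transpose Q"
    using symmetric_matrix_diagonalization[OF sym] .
  have "d j = 0" for j
  proof -
    define v where "v = column j Q"
    have n: "norm v = 1" using Q by (simp add: v_def orthogonal_matrix_orthonormal_columns)
    then have v: "v \<noteq> 0" by force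
    have Dv: "D *v v = d j *\<^sub>R v"
      unfolding v_def DQ by (rule diagonalized_eigenvector[OF Q])
    have "v \<bullet> (D *v (C *v v)) = (D *v v) \<bullet> (C *v v)"
      by (metis dot_lmul_matrix sym transpose_matrix_vector)
    moreover have "v \<bullet> (B *v (D *v v) + D *v (C *v v)) = 0" by (simp add: zero)
    ultimately have "d j * (v \<bullet> (B *v v) + v \<bullet> (C *v v)) = 0"
      by (simp add: Dv inner_add_right matrix_vector_mult_scaleR algebra_simps)
    moreover have "v \<bullet> (B *v v) + v \<bullet> (C *v v) > 0"
      using B C v by (simp add: positive_definite_def add_pos_pos)
    ultimately show "d j = 0" by simp
  qed
  then have "diagonal_matrix d = mat 0" by (simp add: mat_eq_diagonal_matrix[symmetric] diagonal_matrix_def mat_def vec_eq_iff)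
  then have "D = 0"
    unfolding DQ by (simp add: mat_def vec_eq_iff matrix_matrix_mult_def)
  then show ?thesis by (simp add: D_def)
qed

lemma matrix_inv_eqI:
  fixes A B :: "real^'n^'n"
  assumes "A ** B = mat 1" "B ** A = mat 1"
  shows "matrix_inv A = B"
proof -
  have "A ** matrix_inv A = mat 1 \<and> matrix_inv A ** A = mat 1"
    unfolding matrix_inv_def by (rule someI[of _ B]) (use assms in simp)
  then show ?thesis
    by (metis assms(2) matrix_mul_assoc matrix_mul_lid matrix_mul_rid)
qed

text \<open>
  \<^const>\<open>inv_sqrt\<close> is a definite description, so existence (by diagonalization) and uniqueness are both
  needed before anything can be said about it.
\<close>

lemma inv_sqrt_positive_definite:
  fixes A :: "real^'n^'n"
  assumes A: "positive_definite A"
  shows "positive_definite (inv_sqrt A)" and "inv_sqrt A ** inv_sqrt A = matrix_inv A"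
    and "inv_sqrt A ** A ** inv_sqrt A = mat 1"
proof -
  obtain Q d where Q: "orthogonal_matrix Q" and AQ: "A = Q ** diagonal_matrix d ** transpose Q"
    using symmetric_matrix_diagonalization A unfolding positive_definite_def by metis
  have d: "d j > 0" for j
    using A positive_definite_diagonalized_iff[OF Q] AQ by blast
  define B where "B = Q ** diagonal_matrix (\<lambda>j. 1 / sqrt (d j)) ** transpose Q"
  have B: "positive_definite B"
    unfolding B_def positive_definite_diagonalized_iff[OF Q] using d by simp
  have one: "Q ** diagonal_matrix (\<lambda>_. 1) ** transpose Q = mat 1"
    using Q by (simp add: mat_eq_diagonal_matrix[symmetric] orthogonal_matrix_def)
  have sq: "d j / \<bar>d j\<bar> = 1" for j using d[of j] by simp
  have inv: "A ** (B ** B) = mat 1" "(B ** B) ** A = mat 1" and BAB: "B ** A ** B = mat 1"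
    using d by (simp_all add: AQ B_def orthogonal_conjugate_mult[OF Q] sq one)
  have "B ** B = matrix_inv A"
    by (rule matrix_inv_eqI[OF inv, symmetric])
  then have ex1: "\<exists>!B. positive_definite B \<and> B ** B = matrix_inv A"
    using B positive_definite_square_unique by metis
  have "inv_sqrt A = B"
    unfolding inv_sqrt_def by (rule the1_equality[OF ex1]) (use B \<open>B ** B = matrix_inv A\<close> in simp)
  with B \<open>B ** B = matrix_inv A\<close> BAB show "positive_definite (inv_sqrt A)"
    "inv_sqrt A ** inv_sqrt A = matrix_inv A" "inv_sqrt A ** A ** inv_sqrt A = mat 1"
    by simp_all
qed

lemma nonneg_form_invertible_imp_positive_definite:
  fixes A :: "real^'n^'n"
  assumes sym: "transpose A = A" and nonneg: "\<And>x. x \<bullet> (A *v x) \<ge> 0" and "invertible A"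
  shows "positive_definite A"
  unfolding positive_definite_def
proof (intro conjI allI impI sym)
  fix x :: "real^'n" assume "x \<noteq> 0"
  then have "A *v x \<noteq> 0"
    using \<open>invertible A\<close> by (metis invertible_def matrix_vector_mul_assoc matrix_vector_mul_lid matrix_vector_mult_0_right)
  then have "(A *v x) \<bullet> (A *v x) \<noteq> 0" by simp
  then have "x \<bullet> (A *v x) \<noteq> 0"
    using nonneg_form_zero_imp_polar_zero[OF sym subspace_UNIV nonneg] by blast
  with nonneg[of x] show "0 < x \<bullet> (A *v x)" by simp
qed

section \<open>Zonal polynomials of one-part partitions\<close>

text \<open>
  Both enumerations are the root multiset of the characteristic polynomial; equality of the multisets
  is what produces the permutation.
\<close>

lemma eigvals_diagonalized:
  fixes Q :: "real^'n^'n"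
  assumes Q: "orthogonal_matrix Q" and A: "A = Q ** diagonal_matrix d ** transpose Q"
  obtains p where "p permutes UNIV" "\<And>j. eigvals A j = d (p j)"
proof -
  have det: "det (mat x - A) = (\<Prod>j\<in>UNIV. x - d j)" for x
  proof -
    have "Q ** diagonal_matrix (\<lambda>_. x) ** transpose Q = mat x"
    proof -
      have "diagonal_matrix (\<lambda>_. x) = x *\<^sub>R (mat 1 :: real^'n^'n)"
        by (simp add: diagonal_matrix_def mat_def vec_eq_iff)
      then show ?thesis
        using Q by (simp add: matrix_scalar_ac scalar_matrix_assoc[symmetric] orthogonal_matrix_def)
          (simp add: mat_def vec_eq_iff)
    qed
    then have "mat x - A = Q ** (diagonal_matrix (\<lambda>_. x) - diagonal_matrix d) ** transpose Q"
      by (simp add: A matrix_eq matrix_vector_mult_diff_rdistrib matrix_vector_mult_diff_distrib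
          matrix_vector_mul_assoc[symmetric] del: transpose_matrix_vector)
    also have "diagonal_matrix (\<lambda>_. x) - diagonal_matrix d = diagonal_matrix (\<lambda>j. x - d j)"
      by (simp add: diagonal_matrix_def vec_eq_iff)
    finally have "det (mat x - A) = det Q * det (transpose Q) * det (diagonal_matrix (\<lambda>j. x - d j))"
      by (simp add: det_mul)
    also have "det Q * det (transpose Q) = 1"
      using Q by (metis det_I det_mul orthogonal_matrix_def)
    also have "det (diagonal_matrix (\<lambda>j. x - d j)) = (\<Prod>j\<in>UNIV. x - d j)"
      by (subst det_diagonal) (simp_all add: diagonal_matrix_def)
    finally show ?thesis by simp
  qed
  define l where "l = eigvals A"
  have "\<forall>x. det (mat x - A) = (\<Prod>j\<in>UNIV. x - l j)"
    unfolding l_def eigvals_def by (rule someI[of _ d]) (simp add: det)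
  then have eq: "(\<Prod>j\<in>UNIV. x - l j) = (\<Prod>j\<in>UNIV. x - d j)" for x by (simp add: det)
  have "poly (\<Prod>j\<in>UNIV. [:- l j, 1:]) = poly (\<Prod>j\<in>UNIV. [:- d j, 1:])"
    by (rule ext) (simp add: poly_prod eq)
  then have peq: "(\<Prod>j\<in>UNIV. [:- l j, 1:]) = (\<Prod>j\<in>UNIV. [:- d j, 1:])"
    by (simp add: poly_eq_poly_eq_iff)
  have pr: "proots (\<Prod>j\<in>UNIV. [:- l j, 1:]) = image_mset l (mset_set (UNIV :: 'n set))" for l :: "'n \<Rightarrow> real"
  proof -
    have "proots (\<Prod>j\<in>UNIV. [:- l j, 1:]) = (\<Sum>j\<in>UNIV. {#l j#})"
      by (subst proots_prod) auto
    also have "(\<Sum>j\<in>S. {#l j#}) = image_mset l (mset_set S)" if "finite S" for S :: "'n set"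
      using that by induction simp_all
    from this[OF finite] have "(\<Sum>j\<in>UNIV. {#l j#}) = image_mset l (mset_set (UNIV :: 'n set))" .
    finally show ?thesis .
  qed
  have "image_mset l (mset_set (UNIV :: 'n set)) = image_mset d (mset_set UNIV)"
    using peq pr by metis
  then obtain p where "p permutes (UNIV :: 'n set)" "\<forall>j\<in>UNIV. l j = d (p j)"
    using image_mset_eq_implies_permutes[of UNIV l d] by auto
  with that show thesis by (simp add: l_def)
qed

text \<open>
  The zonal polynomial is symmetric in the eigenvalues, hence does not depend on their arbitrary
  enumeration by \<^const>\<open>eigvals\<close>.
\<close>

lemma zonal_diagonalized:
  fixes Q :: "real^'n^'n"
  assumes Q: "orthogonal_matrix Q" and A: "A = Q ** diagonal_matrix d ** transpose Q"
  shows "zonal k A = fact k / pochhammer (1/2) k *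
     (\<Sum>i\<in>{i :: 'n \<Rightarrow> nat. (\<Sum>j\<in>UNIV. i j) = k}.
        \<Prod>j\<in>UNIV. pochhammer (1/2) (i j) * d j ^ i j / fact (i j))"
proof -
  obtain p where p: "p permutes UNIV" "\<And>j. eigvals A j = d (p j)"
    using eigvals_diagonalized[OF assms] by blast
  have bij: "bij p" using p by (simp add: permutes_bij)
  let ?I = "{i :: 'n \<Rightarrow> nat. (\<Sum>j\<in>UNIV. i j) = k}"
  have inv: "inv p permutes UNIV" using p permutes_inv by blast
  have "(\<Sum>i\<in>?I. \<Prod>j\<in>UNIV. pochhammer (1/2) (i j) * d (p j) ^ i j / fact (i j)) =
        (\<Sum>i\<in>?I. \<Prod>j\<in>UNIV. pochhammer (1/2) (i j) * d j ^ i j / fact (i j))"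
  proof (rule sum.reindex_bij_witness[where i = "\<lambda>i. i \<circ> p" and j = "\<lambda>i. i \<circ> inv p"])
    fix i assume "i \<in> ?I"
    then show "i \<circ> p \<in> ?I" and "i \<circ> inv p \<in> ?I"
      using sum.permute[OF p(1), of i] sum.permute[OF inv, of i] by (simp_all add: o_def)
    show "i \<circ> inv p \<circ> p = i" "i \<circ> p \<circ> inv p = i"
      using bij by (auto simp: o_def fun_eq_iff bij_is_inj bij_is_surj surj_f_inv_f)
    show "(\<Prod>j\<in>UNIV. pochhammer (1/2) ((i \<circ> inv p) j) * d j ^ (i \<circ> inv p) j / fact ((i \<circ> inv p) j)) =
       (\<Prod>j\<in>UNIV. pochhammer (1/2) (i j) * d (p j) ^ i j / fact (i j))"
      by (subst prod.permute[OF p(1)]) (simp add: o_def bij bij_is_inj)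
  qed
  then show ?thesis by (simp add: zonal_def p)
qed

text \<open>
  The sums over exponent vectors in zonal polynomials are coefficients of products of power series.
  Exponential series give the multinomial theorem, binomial series the value of the zonal polynomial
  at the identity matrix.
\<close>

lemma fps_nth_prod_UNIV:
  fixes F :: "'n::finite \<Rightarrow> 'a::comm_semiring_1 fps"
  shows "fps_nth (\<Prod>j\<in>UNIV. F j) k =
    (\<Sum>i\<in>{i :: 'n \<Rightarrow> nat. (\<Sum>j\<in>UNIV. i j) = k}. \<Prod>j\<in>UNIV. fps_nth (F j) (i j))"
proof -
  have "bij_betw count (multisets_of_size (UNIV :: 'n set) k) {i. (\<Sum>j\<in>UNIV. i j) = k}"
  proof (rule bij_betw_byWitness[where f' = Abs_multiset])
    have size: "size X = (\<Sum>j\<in>UNIV. count X j)" for X :: "'n multiset"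
      unfolding size_multiset_overloaded_eq
      by (rule sum.mono_neutral_left) (auto simp: not_in_iff)
    show "count ` multisets_of_size (UNIV :: 'n set) k \<subseteq> {i. (\<Sum>j\<in>UNIV. i j) = k}"
      by (auto simp: multisets_of_size_def size[symmetric])
    show "Abs_multiset ` {i. (\<Sum>j\<in>UNIV. i j) = k} \<subseteq> multisets_of_size (UNIV :: 'n set) k"
      by (auto simp: multisets_of_size_def size)
  qed (auto simp: count_inverse)
  then have "(\<Sum>X\<in>multisets_of_size UNIV k. \<Prod>j\<in>UNIV. fps_nth (F j) (count X j)) =
    (\<Sum>i\<in>{i :: 'n \<Rightarrow> nat. (\<Sum>j\<in>UNIV. i j) = k}. \<Prod>j\<in>UNIV. fps_nth (F j) (i j))"
    by (rule sum.reindex_bij_betw)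
  then show ?thesis by (simp add: fps_prod_nth')
qed

lemma multinomial_theorem:
  fixes x :: "'n::finite \<Rightarrow> real"
  shows "(\<Sum>j\<in>UNIV. x j) ^ k =
    fact k * (\<Sum>i\<in>{i :: 'n \<Rightarrow> nat. (\<Sum>j\<in>UNIV. i j) = k}. \<Prod>j\<in>UNIV. x j ^ i j / fact (i j))"
proof -
  have "(\<Prod>j\<in>S. fps_exp (x j)) = fps_exp (\<Sum>j\<in>S. x j)" if "finite S" for S
    using that by induction (simp_all add: fps_exp_add_mult)
  then have "fps_nth (\<Prod>j\<in>UNIV. fps_exp (x j)) k = (\<Sum>j\<in>UNIV. x j) ^ k / fact k"
    by simp
  then show ?thesis by (simp add: fps_nth_prod_UNIV field_simps)
qed

lemma pochhammer_multinomial: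
  fixes a :: real
  shows "(\<Sum>i\<in>{i :: 'n::finite \<Rightarrow> nat. (\<Sum>j\<in>UNIV. i j) = k}. \<Prod>j\<in>UNIV. pochhammer a (i j) / fact (i j)) =
    pochhammer (real CARD('n) * a) k / fact k"
proof -
  have poch: "pochhammer b m / fact m = (-1) ^ m * (- b gchoose m)" for b :: real and m
    by (simp add: gbinomial_pochhammer power_mult_distrib[symmetric])
  have "fps_nth (\<Prod>j\<in>(UNIV :: 'n set). fps_binomial (- a)) k = (- (real CARD('n) * a) gchoose k)"
    by (simp add: fps_binomial_power)
  then have "(- (real CARD('n) * a) gchoose k) =
    (\<Sum>i\<in>{i :: 'n \<Rightarrow> nat. (\<Sum>j\<in>UNIV. i j) = k}. \<Prod>j\<in>UNIV. (- a gchoose i j))"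
    by (simp only: fps_nth_prod_UNIV fps_binomial_nth)
  moreover have "(\<Prod>j\<in>UNIV. pochhammer a (i j) / fact (i j)) = (-1) ^ k * (\<Prod>j\<in>UNIV. (- a gchoose i j))"
    if "i \<in> {i :: 'n \<Rightarrow> nat. (\<Sum>j\<in>UNIV. i j) = k}" for i
    using that by (simp add: poch prod.distrib power_sum[symmetric])
  then have "(\<Sum>i\<in>{i :: 'n \<Rightarrow> nat. (\<Sum>j\<in>UNIV. i j) = k}. \<Prod>j\<in>UNIV. pochhammer a (i j) / fact (i j)) =
    (-1) ^ k * (\<Sum>i\<in>{i :: 'n \<Rightarrow> nat. (\<Sum>j\<in>UNIV. i j) = k}. \<Prod>j\<in>UNIV. (- a gchoose i j))"
    unfolding sum_distrib_left by (rule sum.cong[OF refl])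
  ultimately show ?thesis by (simp add: poch)
qed

text \<open>
  The upper bound is the value at the identity matrix, since each monomial is monotone in the
  eigenvalues.
\<close>

lemma zonal_nonneg_le:
  fixes Q :: "real^'n^'n"
  assumes Q: "orthogonal_matrix Q" and A: "A = Q ** diagonal_matrix d ** transpose Q"
    and d: "\<And>j. 0 \<le> d j" "\<And>j. d j \<le> 1"
  shows "0 \<le> zonal k A" "zonal k A \<le> pochhammer (real CARD('n) / 2) k / pochhammer (1/2) k"
proof -
  let ?I = "{i :: 'n \<Rightarrow> nat. (\<Sum>j\<in>UNIV. i j) = k}"
  have pos: "pochhammer (1/2 :: real) m > 0" for m by (rule pochhammer_pos) simp
  show "0 \<le> zonal k A"
    unfolding zonal_diagonalized[OF Q A]
    by (intro mult_nonneg_nonneg sum_nonneg prod_nonneg ballI divide_nonneg_nonneg zero_le_power d less_imp_le[OF pos]) auto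
  have "(\<Sum>i\<in>?I. \<Prod>j\<in>UNIV. pochhammer (1/2) (i j) * d j ^ i j / fact (i j)) \<le>
    (\<Sum>i\<in>?I. \<Prod>j\<in>UNIV. pochhammer (1/2) (i j) / fact (i j))"
  proof (intro sum_mono prod_mono conjI)
    fix i :: "'n \<Rightarrow> nat" and j
    show "0 \<le> pochhammer (1/2) (i j) * d j ^ i j / fact (i j)"
      using pos[of "i j"] d[of j] by simp
    have "d j ^ i j \<le> 1" using d by (intro power_le_one)
    then show "pochhammer (1/2) (i j) * d j ^ i j / fact (i j) \<le> pochhammer (1/2) (i j) / fact (i j)"
      using pos[of "i j"] by (intro divide_right_mono) (simp_all add: mult_le_cancel_left2)
  qed
  also have "\<dots> = pochhammer (real CARD('n) / 2) k / fact k"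
    by (simp add: pochhammer_multinomial)
  finally show "zonal k A \<le> pochhammer (real CARD('n) / 2) k / pochhammer (1/2) k"
    unfolding zonal_diagonalized[OF Q A] using pos[of k] by (simp add: field_simps)
qed

section \<open>Rotation invariance of Lebesgue measure\<close>

lemma nn_integral_lborel_translate:
  fixes f :: "'a::euclidean_space \<Rightarrow> ennreal"
  assumes [measurable]: "f \<in> borel_measurable borel"
  shows "(\<integral>\<^sup>+x. f (a + x) \<partial>lborel) = (\<integral>\<^sup>+x. f x \<partial>lborel)"
proof -
  have "(\<integral>\<^sup>+x. f x \<partial>lborel) = (\<integral>\<^sup>+x. f x \<partial>distr lborel borel ((+) a))"
    by (simp add: lborel_distr_plus)
  also have "\<dots> = (\<integral>\<^sup>+x. f (a + x) \<partial>lborel)"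
    by (subst nn_integral_distr) simp_all
  finally show ?thesis ..
qed

lemma borel_measurable_matrix_vector_mult [measurable]:
  fixes A :: "real^'n^'m"
  assumes [measurable]: "f \<in> borel_measurable M"
  shows "(\<lambda>x. A *v f x) \<in> borel_measurable M"
  by (rule borel_measurable_continuous_on[OF _ assms]) (intro continuous_intros)

lemma orthogonal_matrix_norm:
  fixes Q :: "real^'n^'n"
  assumes "orthogonal_matrix Q"
  shows "norm (Q *v x) = norm x" "transpose Q *v (Q *v x) = x" "Q *v (transpose Q *v x) = x"
proof -
  show *: "transpose Q *v (Q *v x) = x" "Q *v (transpose Q *v x) = x"
    using assms by (simp_all add: matrix_vector_mul_assoc orthogonal_matrix_def del: transpose_matrix_vector)
  have "(Q *v x) \<bullet> (Q *v x) = x \<bullet> (transpose Q *v (Q *v x))"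
    by (metis dot_lmul_matrix inner_commute transpose_matrix_vector)
  then show "norm (Q *v x) = norm x" by (simp only: *(1) norm_eq)
qed

lemma orthogonal_matrix_inner:
  fixes Q :: "real^'n^'n"
  assumes "orthogonal_matrix Q"
  shows "(Q *v x) \<bullet> (Q *v y) = x \<bullet> y"
proof -
  have "(Q *v x) \<bullet> (Q *v y) = x \<bullet> (transpose Q *v (Q *v y))"
    by (metis dot_lmul_matrix inner_commute transpose_matrix_vector)
  then show ?thesis by (simp only: orthogonal_matrix_norm[OF assms])
qed

text \<open>
  Haar uniqueness by Tonelli.  With \<open>I\<close> the indicator of the unit ball and \<open>c\<close> its volume,
  \<open>\<integral>\<integral> f (Q x) I (y - Q x) dy dx\<close> is \<open>c \<integral> f (Q x) dx\<close> by translation in \<open>y\<close>.  Substituting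
  \<open>x + Q\<^sup>T y\<close> for \<open>x\<close> first and then translating in \<open>y\<close> gives \<open>c \<integral> f\<close> instead, because the ball is
  invariant under \<open>- Q\<close>.
\<close>

lemma nn_integral_lborel_orthogonal:
  fixes f :: "real^'n \<Rightarrow> ennreal" and Q :: "real^'n^'n"
  assumes Q: "orthogonal_matrix Q" and f[measurable]: "f \<in> borel_measurable borel"
  shows "(\<integral>\<^sup>+x. f (Q *v x) \<partial>lborel) = (\<integral>\<^sup>+x. f x \<partial>lborel)"
proof -
  define I :: "real^'n \<Rightarrow> ennreal" where "I = indicator (cball 0 1)"
  define c where "c = (\<integral>\<^sup>+x. I x \<partial>lborel)"
  have [measurable]: "I \<in> borel_measurable borel" unfolding I_def by (rule borel_measurable_indicator) simp
  have c: "c = emeasure lborel (cball (0 :: real^'n) 1)"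
    by (simp add: c_def I_def)
  have "c > 0"
    unfolding c using content_cball_pos[of 1 "0 :: real^'n"]
    by (cases "emeasure lborel (cball (0 :: real^'n) 1) = 0") (simp_all add: measure_def zero_less_iff_neq_zero)
  moreover have "c < \<infinity>" using emeasure_lborel_cball_finite unfolding c by simp
  moreover have "(\<integral>\<^sup>+x. f (Q *v x) \<partial>lborel) * c = (\<integral>\<^sup>+x. f x \<partial>lborel) * c"
  proof -
    have "(\<integral>\<^sup>+x. f (Q *v x) \<partial>lborel) * c = (\<integral>\<^sup>+x. \<integral>\<^sup>+y. f (Q *v x) * I (- (Q *v x) + y) \<partial>lborel \<partial>lborel)"
      using nn_integral_lborel_translate[of I "- (Q *v x)" for x]
      by (simp add: c_def nn_integral_cmult nn_integral_multc)
    also have "\<dots> = (\<integral>\<^sup>+y. \<integral>\<^sup>+x. f (Q *v x) * I (- (Q *v x) + y) \<partial>lborel \<partial>lborel)"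
      by (rule lborel_pair.Fubini'[symmetric]) measurable
    also have "\<dots> = (\<integral>\<^sup>+y. \<integral>\<^sup>+x. f (y + Q *v x) * I (- (Q *v x)) \<partial>lborel \<partial>lborel)"
    proof (rule nn_integral_cong)
      fix y
      have "(\<integral>\<^sup>+x. f (Q *v x) * I (- (Q *v x) + y) \<partial>lborel) =
        (\<integral>\<^sup>+x. f (Q *v (transpose Q *v y + x)) * I (- (Q *v (transpose Q *v y + x)) + y) \<partial>lborel)"
        by (rule nn_integral_lborel_translate[symmetric]) measurable
      then show "(\<integral>\<^sup>+x. f (Q *v x) * I (- (Q *v x) + y) \<partial>lborel) = (\<integral>\<^sup>+x. f (y + Q *v x) * I (- (Q *v x)) \<partial>lborel)"
        by (simp add: matrix_vector_right_distrib orthogonal_matrix_norm[OF Q] del: transpose_matrix_vector)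
    qed
    also have "\<dots> = (\<integral>\<^sup>+x. \<integral>\<^sup>+y. f (Q *v x + y) * I (- (Q *v x)) \<partial>lborel \<partial>lborel)"
      by (subst lborel_pair.Fubini') (measurable, simp add: add.commute)
    also have "\<dots> = (\<integral>\<^sup>+x. (\<integral>\<^sup>+y. f y \<partial>lborel) * I (- (Q *v x)) \<partial>lborel)"
      by (simp add: nn_integral_multc nn_integral_lborel_translate)
    also have "\<dots> = (\<integral>\<^sup>+x. f x \<partial>lborel) * c"
      by (simp add: nn_integral_cmult c_def I_def indicator_def orthogonal_matrix_norm[OF Q])
    finally show ?thesis .
  qed
  ultimately show ?thesis
    by (auto simp: mult.commute[of _ c] ennreal_mult_cancel_left)
qed

lemma nn_integral_lborel_uminus:
  fixes f :: "'a::euclidean_space \<Rightarrow> ennreal"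
  assumes [measurable]: "f \<in> borel_measurable borel"
  shows "(\<integral>\<^sup>+x. f (- x) \<partial>lborel) = (\<integral>\<^sup>+x. f x \<partial>lborel)"
proof -
  have "distr lborel borel (\<lambda>x :: 'a. - x) = lborel"
    using lborel_affine[of "-1" "0 :: 'a"] by (simp add: density_1)
  then have "(\<integral>\<^sup>+x. f x \<partial>lborel) = (\<integral>\<^sup>+x. f x \<partial>distr lborel borel (\<lambda>x :: 'a. - x))"
    by simp
  also have "\<dots> = (\<integral>\<^sup>+x. f (- x) \<partial>lborel)"
    by (subst nn_integral_distr) simp_all
  finally show ?thesis ..
qed

section \<open>Moments of the weight exp(-|t|^2) / |t|^(n+1)\<close>

lemma borel_measurable_vec_component [measurable (raw)]:
  fixes f :: "'a \<Rightarrow> real^'n"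
  assumes "f \<in> borel_measurable M"
  shows "(\<lambda>x. f x $ j) \<in> borel_measurable M"
  by (rule borel_measurable_continuous_on[OF _ assms]) (intro continuous_intros)

lemma nn_integral_gamma_kernel:
  assumes z: "z > 0" and c: "c > 0"
  shows "(\<integral>\<^sup>+u. ennreal (indicator {0<..} u * (u powr (z - 1) * exp (- (c * u)))) \<partial>lborel) =
    ennreal (Gamma z * c powr (- z))"
proof -
  define g :: "real \<Rightarrow> ennreal" where "g = (\<lambda>t. ennreal (indicator {0..} t * t powr (z - 1) / exp t))"
  have [measurable]: "g \<in> borel_measurable borel" unfolding g_def by measurable
  have "ennreal (indicator {0<..} u * (u powr (z - 1) * exp (- (c * u)))) = ennreal (c powr (1 - z)) * g (0 + c * u)"
    if "u \<noteq> 0" for u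
  proof (cases "u > 0")
    case True
    then show ?thesis using c
      by (simp add: g_def ennreal_mult'[symmetric] powr_mult exp_minus field_simps powr_add[symmetric] powr_diff)
  next
    case False
    with that have "c * u < 0" using c by (simp add: mult_pos_neg)
    then show ?thesis using False by (simp add: g_def)
  qed
  then have "(\<integral>\<^sup>+u. ennreal (indicator {0<..} u * (u powr (z - 1) * exp (- (c * u)))) \<partial>lborel) =
    (\<integral>\<^sup>+u. ennreal (c powr (1 - z)) * g (0 + c * u) \<partial>lborel)"
    using AE_lborel_singleton[of "0 :: real"] by (intro nn_integral_cong_AE) auto
  also have "\<dots> = ennreal (c powr (1 - z)) * (\<integral>\<^sup>+u. g (0 + c * u) \<partial>lborel)"
    by (rule nn_integral_cmult) measurable
  also have "\<dots> = ennreal (c powr (- z)) * (ennreal c * (\<integral>\<^sup>+u. g (0 + c * u) \<partial>lborel))"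
    using c by (simp add: powr_diff powr_minus ennreal_mult'[symmetric] divide_inverse mult.commute flip: mult.assoc)
  also have "ennreal c * (\<integral>\<^sup>+u. g (0 + c * u) \<partial>lborel) = ennreal (Gamma z)"
    using nn_integral_real_affine[of g c 0] c Gamma_conv_nn_integral_real[OF z] by (simp add: g_def)
  finally show ?thesis using z by (simp add: ennreal_mult'[symmetric] mult.commute)
qed

lemma exp_neg_one_plus_mult: "exp (- ((1 + u) * x)) = exp (- x) * exp (- (x * u))" for u x :: real
  by (simp add: exp_add[symmetric] algebra_simps)

text \<open>
  The factor \<open>(1 + u) powr - (a + b)\<close> is itself a Gamma integral; exchanging the two integrals leaves
  Gamma integrals only.
\<close>

lemma nn_integral_beta_kernel:
  assumes a: "a > 0" and b: "b > 0"
  shows "(\<integral>\<^sup>+u. ennreal (indicator {0<..} u * (u powr (b - 1) * (1 + u) powr (- (a + b)))) \<partial>lborel) =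
    ennreal (Gamma a * Gamma b / Gamma (a + b))"
proof -
  let ?h = "\<lambda>u v :: real. ennreal (indicator {0<..} u * (u powr (b - 1)) *
     (indicator {0<..} v * (v powr (a + b - 1) * exp (- ((1 + u) * v)))))"
  have G: "Gamma (a + b) > 0" using a b by (simp add: Gamma_real_pos)
  have "ennreal (Gamma (a + b)) * (\<integral>\<^sup>+u. ennreal (indicator {0<..} u * (u powr (b - 1) * (1 + u) powr (- (a + b)))) \<partial>lborel)
    = (\<integral>\<^sup>+u. ennreal (Gamma (a + b)) * ennreal (indicator {0<..} u * (u powr (b - 1) * (1 + u) powr (- (a + b)))) \<partial>lborel)"
    by (rule nn_integral_cmult[symmetric]) measurable
  also have "\<dots> = (\<integral>\<^sup>+u. \<integral>\<^sup>+v. ?h u v \<partial>lborel \<partial>lborel)"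
  proof (rule nn_integral_cong)
    fix u :: real
    show "ennreal (Gamma (a + b)) * ennreal (indicator {0<..} u * (u powr (b - 1) * (1 + u) powr (- (a + b)))) =
      (\<integral>\<^sup>+v. ?h u v \<partial>lborel)"
    proof (cases "u > 0")
      case True
      have "(\<integral>\<^sup>+v. ?h u v \<partial>lborel) = ennreal (u powr (b - 1)) *
        (\<integral>\<^sup>+v. ennreal (indicator {0<..} v * (v powr (a + b - 1) * exp (- ((1 + u) * v)))) \<partial>lborel)"
        using True by (subst nn_integral_cmult[symmetric]) (measurable, simp add: ennreal_mult')
      also have "\<dots> = ennreal (u powr (b - 1)) * ennreal (Gamma (a + b) * (1 + u) powr (- (a + b)))"
        using a b True by (subst nn_integral_gamma_kernel) simp_all
      finally show ?thesis
        using True G by (simp add: ennreal_mult'[symmetric] mult_ac)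
    qed simp
  qed
  also have "\<dots> = (\<integral>\<^sup>+v. \<integral>\<^sup>+u. ?h u v \<partial>lborel \<partial>lborel)"
    by (rule lborel_pair.Fubini') measurable
  also have "\<dots> = (\<integral>\<^sup>+v. ennreal (Gamma b) * ennreal (indicator {0<..} v * (v powr (a - 1) * exp (- (1 * v)))) \<partial>lborel)"
  proof (rule nn_integral_cong)
    fix v :: real
    show "(\<integral>\<^sup>+u. ?h u v \<partial>lborel) = ennreal (Gamma b) * ennreal (indicator {0<..} v * (v powr (a - 1) * exp (- (1 * v))))"
    proof (cases "v > 0")
      case True
      have "(\<integral>\<^sup>+u. ?h u v \<partial>lborel) = (\<integral>\<^sup>+u. ennreal (v powr (a + b - 1) * exp (- v)) *
          ennreal (indicator {0<..} u * (u powr (b - 1) * exp (- (v * u)))) \<partial>lborel)"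
        using True by (intro nn_integral_cong) (simp only: exp_neg_one_plus_mult, simp add: ennreal_mult'[symmetric] mult_ac)
      also have "\<dots> = ennreal (v powr (a + b - 1) * exp (- v)) *
        (\<integral>\<^sup>+u. ennreal (indicator {0<..} u * (u powr (b - 1) * exp (- (v * u)))) \<partial>lborel)"
        by (rule nn_integral_cmult) measurable
      also have "\<dots> = ennreal (v powr (a + b - 1) * exp (- v)) * ennreal (Gamma b * v powr (- b))"
        by (simp only: nn_integral_gamma_kernel[OF b True])
      also have "\<dots> = ennreal (Gamma b * (v powr (a + b - 1) * v powr (- b) * exp (- v)))"
        using Gamma_real_pos[OF b] by (simp add: ennreal_mult'[symmetric] mult_ac)
      also have "v powr (a + b - 1) * v powr (- b) = v powr (a - 1)"
        by (simp add: powr_add[symmetric])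
      finally show ?thesis
        using True b Gamma_real_pos[OF b] by (simp add: ennreal_mult'[symmetric])
    qed simp
  qed
  also have "\<dots> = ennreal (Gamma b) * (\<integral>\<^sup>+v. ennreal (indicator {0<..} v * (v powr (a - 1) * exp (- (1 * v)))) \<partial>lborel)"
    by (rule nn_integral_cmult) measurable
  also have "\<dots> = ennreal (Gamma b) * ennreal (Gamma a)"
    by (subst nn_integral_gamma_kernel[OF a]) simp_all
  also have "\<dots> = ennreal (Gamma (a + b)) * ennreal (Gamma a * Gamma b / Gamma (a + b))"
    using G Gamma_real_pos[OF a] Gamma_real_pos[OF b] by (simp add: ennreal_mult'[symmetric] mult.commute)
  finally show ?thesis
    using G by (simp add: ennreal_mult_cancel_left)
qed

lemma nn_integral_gaussian_even_moment:
  assumes c: "c > 0"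
  shows "(\<integral>\<^sup>+t. ennreal (t ^ (2 * k) * exp (- (c * t\<^sup>2))) \<partial>lborel) =
    ennreal (sqrt pi * pochhammer (1/2) k * c powr (- (1/2 + real k)))"
proof -
  define s where "s = 1 / sqrt (2 * c)"
  have s: "s > 0" "s\<^sup>2 = 1 / (2 * c)" using c by (simp_all add: s_def power_divide)
  then have s4: "2 / s\<^sup>2 = 4 * c" by simp
  have "has_bochner_integral lborel (\<lambda>x. normal_density 0 s x * (x - 0) ^ (2 * k)) (fact (2 * k) / ((2 / s\<^sup>2)^k * fact k))"
    by (rule normal_moment_even[OF s(1)])
  then have "has_bochner_integral lborel (\<lambda>x. sqrt (pi / c) * (normal_density 0 s x * (x - 0) ^ (2 * k)))
     (sqrt (pi / c) * (fact (2 * k) / ((2 / s\<^sup>2)^k * fact k)))"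
    by (rule has_bochner_integral_mult_right) 
  also have "(\<lambda>x. sqrt (pi / c) * (normal_density 0 s x * (x - 0) ^ (2 * k))) = (\<lambda>t. t ^ (2 * k) * exp (- (c * t\<^sup>2)))"
    using c by (simp add: normal_density_def s real_sqrt_divide field_simps fun_eq_iff)
  also have "sqrt (pi / c) * (fact (2 * k) / ((2 / s\<^sup>2)^k * fact k)) = sqrt pi * pochhammer (1/2) k / (sqrt c * c ^ k)"
    unfolding s4 using c by (simp add: fact_double real_sqrt_divide power_mult power_mult_distrib)
  also have "\<dots> = sqrt pi * pochhammer (1/2) k * c powr (- (1/2 + real k))"
  proof -
    have "c powr (1/2 + real k) = sqrt c * c ^ k"
      using c by (simp only: powr_add powr_half_sqrt[OF less_imp_le] powr_realpow)
    then show ?thesis by (simp only: powr_minus divide_inverse)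
  qed
  finally have *: "has_bochner_integral lborel (\<lambda>t. t ^ (2 * k) * exp (- (c * t\<^sup>2)))
     (sqrt pi * pochhammer (1/2) k * c powr (- (1/2 + real k)))" .
  show ?thesis
    using nn_integral_eq_integral[OF integrable.intros[OF *]] has_bochner_integral_integral_eq[OF *]
    by (simp add: power_mult)
qed

lemma nn_integral_lborel_vec_prod:
  fixes f :: "'n::finite \<Rightarrow> real \<Rightarrow> ennreal"
  assumes [measurable]: "\<And>j. f j \<in> borel_measurable borel"
  shows "(\<integral>\<^sup>+x. (\<Prod>j\<in>UNIV. f j (x $ j)) \<partial>(lborel :: (real^'n) measure)) = (\<Prod>j\<in>UNIV. \<integral>\<^sup>+x. f j x \<partial>lborel)"
proof -
  have basis: "(\<Prod>b\<in>Basis. g b) = (\<Prod>j\<in>UNIV. g (axis j 1))" for g :: "real^'n \<Rightarrow> ennreal"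
  proof -
    have "Basis = range (\<lambda>j. axis j 1 :: real^'n)" by (auto simp: Basis_vec_def)
    moreover have "inj (\<lambda>j. axis j 1 :: real^'n)" by (auto simp: inj_def axis_eq_axis)
    ultimately have "prod g Basis = (\<Prod>j\<in>UNIV. (g \<circ> (\<lambda>j. axis j 1)) j)"
      by (metis prod.reindex)
    then show ?thesis by simp
  qed
  have "(\<integral>\<^sup>+x. (\<Prod>b\<in>Basis. f (axis_index b) (x \<bullet> b)) \<partial>(lborel :: (real^'n) measure)) =
    (\<Prod>b\<in>(Basis :: (real^'n) set). \<integral>\<^sup>+x. f (axis_index b) x \<partial>lborel)"
    by (rule nn_integral_lborel_prod) simp_all
  then show ?thesis by (simp add: basis inner_axis)
qed

lemma norm_squared_eq_sum: "(norm (x :: real^'n))\<^sup>2 = (\<Sum>j\<in>UNIV. (x $ j)\<^sup>2)"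
  unfolding power2_norm_eq_inner inner_vec_def by (simp add: power2_eq_square)

lemma nn_integral_gaussian_monomial:
  fixes i :: "'n::finite \<Rightarrow> nat"
  assumes c: "c > 0"
  shows "(\<integral>\<^sup>+t. ennreal ((\<Prod>j\<in>UNIV. (t $ j) ^ (2 * i j)) * exp (- (c * (norm t)\<^sup>2))) \<partial>(lborel :: (real^'n) measure)) =
    ennreal (pi powr (real CARD('n) / 2) * (\<Prod>j\<in>UNIV. pochhammer (1/2) (i j)) *
      c powr (- (real CARD('n) / 2 + real (\<Sum>j\<in>UNIV. i j))))"
proof -
  have "(\<Prod>j\<in>UNIV. (t $ j) ^ (2 * i j)) * exp (- (c * (norm t)\<^sup>2)) = (\<Prod>j\<in>UNIV. (t $ j) ^ (2 * i j) * exp (- (c * (t $ j)\<^sup>2)))"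
    for t :: "real^'n"
    by (simp add: norm_squared_eq_sum sum_distrib_left prod.distrib exp_sum sum_negf[symmetric])
  then have "(\<integral>\<^sup>+t. ennreal ((\<Prod>j\<in>UNIV. (t $ j) ^ (2 * i j)) * exp (- (c * (norm t)\<^sup>2))) \<partial>(lborel :: (real^'n) measure)) =
    (\<integral>\<^sup>+t. (\<Prod>j\<in>UNIV. ennreal ((t $ j) ^ (2 * i j) * exp (- (c * (t $ j)\<^sup>2)))) \<partial>(lborel :: (real^'n) measure))"
    by (simp add: prod_ennreal power_mult)
  also have "\<dots> = (\<Prod>j\<in>UNIV. ennreal (sqrt pi * pochhammer (1/2) (i j) * c powr (- (1/2 + real (i j)))))"
    by (subst nn_integral_lborel_vec_prod) (simp_all add: nn_integral_gaussian_even_moment[OF c])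
  also have "\<dots> = ennreal (\<Prod>j\<in>UNIV. sqrt pi * pochhammer (1/2) (i j) * c powr (- (1/2 + real (i j))))"
    by (intro prod_ennreal) (auto intro!: mult_nonneg_nonneg pochhammer_nonneg)
  also have "(\<Prod>j\<in>UNIV. sqrt pi * pochhammer (1/2) (i j) * c powr (- (1/2 + real (i j)))) =
     sqrt pi ^ CARD('n) * (\<Prod>j\<in>UNIV. pochhammer (1/2) (i j)) * c powr (\<Sum>j\<in>UNIV. (- (1/2 + real (i j))))"
    using c by (simp add: prod.distrib powr_sum)
  also have "(\<Sum>j\<in>(UNIV :: 'n set). (- (1/2 + real (i j)))) = - (real CARD('n) / 2 + real (\<Sum>j\<in>UNIV. i j))"
    by (simp only: sum_negf sum.distrib) simp
  also have "sqrt pi ^ CARD('n) = pi powr (real CARD('n) / 2)"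
    by (simp add: powr_half_sqrt[symmetric] powr_realpow[symmetric] powr_powr)
  finally show ?thesis .
qed

text \<open>
  The part of the dependence integrand that stems from one of the two marginals: a Gaussian over the
  singular kernel of distance covariance.
\<close>

definition radial_weight :: "real^'n \<Rightarrow> real" where
  "radial_weight t = exp (- (norm t)\<^sup>2) / norm t ^ (CARD('n) + 1)"

lemma radial_weight_nonneg [simp]: "radial_weight t \<ge> 0"
  by (simp add: radial_weight_def)

lemma borel_measurable_radial_weight [measurable]: "radial_weight \<in> borel_measurable borel"
  unfolding radial_weight_def by measurable

text \<open>
  Writing the power of \<open>norm t\<close> as a Gamma integral turns the weight into a mixture of Gaussians,
  whose moments factor over the coordinates.
\<close>

lemma radial_weight_eq_gamma_integral:
  fixes t :: "real^'n"
  assumes "t \<noteq> 0"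
  defines "b \<equiv> (real CARD('n) + 1) / 2"
  shows "ennreal (Gamma b * radial_weight t) =
    (\<integral>\<^sup>+u. ennreal (indicator {0<..} u * (u powr (b - 1) * exp (- ((1 + u) * (norm t)\<^sup>2)))) \<partial>lborel)"
proof -
  have b: "b > 0" by (simp add: b_def add_pos_nonneg)
  have t: "(norm t)\<^sup>2 > 0" using assms(1) by simp
  have "(\<integral>\<^sup>+u. ennreal (indicator {0<..} u * (u powr (b - 1) * exp (- ((1 + u) * (norm t)\<^sup>2)))) \<partial>lborel) =
    (\<integral>\<^sup>+u. ennreal (exp (- (norm t)\<^sup>2)) * ennreal (indicator {0<..} u * (u powr (b - 1) * exp (- ((norm t)\<^sup>2 * u)))) \<partial>lborel)"
    by (intro nn_integral_cong) (simp only: exp_neg_one_plus_mult, simp add: ennreal_mult'[symmetric] mult_ac)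
  also have "\<dots> = ennreal (exp (- (norm t)\<^sup>2)) * ennreal (Gamma b * (norm t)\<^sup>2 powr (- b))"
    by (subst nn_integral_cmult) (measurable, simp only: nn_integral_gamma_kernel[OF b t])
  also have "(norm t)\<^sup>2 powr (- b) = 1 / norm t ^ (CARD('n) + 1)"
  proof -
    have "(norm t)\<^sup>2 = norm t powr 2" using t by (simp add: powr_numeral)
    then have "(norm t)\<^sup>2 powr (- b) = norm t powr (2 * (- b))" by (simp only: powr_powr)
    also have "2 * (- b) = - real (CARD('n) + 1)" by (simp add: b_def field_simps)
    moreover have "norm t powr real (CARD('n) + 1) = norm t ^ (CARD('n) + 1)"
      using t by (intro powr_realpow) simp
    ultimately show ?thesis by (simp only: powr_minus divide_inverse mult_1_left)
  qed
  finally show ?thesis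
    using b Gamma_real_pos[OF b] by (simp add: ennreal_mult'[symmetric] radial_weight_def mult_ac)
qed

text \<open>
  By the Gaussian mixture the Gaussian moments remain to be integrated against \<open>u powr (b - 1)\<close>, a Beta
  integral with \<open>a = k - 1/2\<close>.  For \<open>k = 0\<close> the singularity at the origin is not integrable.
\<close>

lemma nn_integral_radial_weight_monomial:
  fixes i :: "'n::finite \<Rightarrow> nat"
  assumes i: "(\<Sum>j\<in>UNIV. i j) = k" and k: "k > 0"
  shows "(\<integral>\<^sup>+t. ennreal (radial_weight t * (\<Prod>j\<in>UNIV. (t $ j) ^ (2 * i j))) \<partial>(lborel :: (real^'n) measure)) =
    ennreal (pi powr (real CARD('n) / 2) * (Gamma (real k - 1/2) / Gamma (real CARD('n) / 2 + real k)) *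
      (\<Prod>j\<in>UNIV. pochhammer (1/2) (i j)))"
proof -
  define b where "b = (real CARD('n) + 1) / 2"
  define a where "a = real k - 1/2"
  have b: "b > 0" by (simp add: b_def add_pos_nonneg)
  have a: "a > 0" using k by (simp add: a_def)
  have ab: "a + b = real CARD('n) / 2 + real k" by (simp add: a_def b_def add_divide_distrib)
  define P where "P = pi powr (real CARD('n) / 2) * (\<Prod>j\<in>UNIV. pochhammer (1/2) (i j))"
  have P: "P \<ge> 0" unfolding P_def by (intro mult_nonneg_nonneg prod_nonneg) (auto intro!: pochhammer_nonneg)
  let ?m = "\<lambda>t :: real^'n. \<Prod>j\<in>UNIV. (t $ j) ^ (2 * i j)"
  let ?h = "\<lambda>(t :: real^'n) u. ennreal (?m t * (indicator {0<..} u * (u powr (b - 1) * exp (- ((1 + u) * (norm t)\<^sup>2)))))"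
  have m: "?m t \<ge> 0" for t by (intro prod_nonneg) (auto simp: power_mult)
  have G: "Gamma b > 0" using b by (rule Gamma_real_pos)
  have "ennreal (Gamma b) * (\<integral>\<^sup>+t. ennreal (radial_weight t * ?m t) \<partial>lborel) =
    (\<integral>\<^sup>+t. ennreal (Gamma b) * ennreal (radial_weight t * ?m t) \<partial>lborel)"
    by (rule nn_integral_cmult[symmetric]) measurable
  \<comment> \<open>At \<open>t = 0\<close> the weight has the default value \<open>0\<close>, so its Gamma integral represents it almost
      everywhere only.\<close>
  also have "\<dots> = (\<integral>\<^sup>+t. \<integral>\<^sup>+u. ?h t u \<partial>lborel \<partial>lborel)"
  proof (rule nn_integral_cong_AE)
    show "AE t in (lborel :: (real^'n) measure). ennreal (Gamma b) * ennreal (radial_weight t * ?m t) = (\<integral>\<^sup>+u. ?h t u \<partial>lborel)"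
      using AE_lborel_singleton[of "0 :: real^'n"]
    proof eventually_elim
      case (elim t)
      have "(\<integral>\<^sup>+u. ?h t u \<partial>lborel) = ennreal (?m t) * ennreal (Gamma b * radial_weight t)"
        unfolding b_def radial_weight_eq_gamma_integral[OF elim] 
        by (subst nn_integral_cmult[symmetric]) (measurable, simp add: ennreal_mult' m)
      then show ?case using G m[of t] by (simp add: ennreal_mult'[symmetric] mult_ac)
    qed
  qed
  also have "\<dots> = (\<integral>\<^sup>+u. \<integral>\<^sup>+t. ?h t u \<partial>lborel \<partial>lborel)"
    by (rule lborel_pair.Fubini'[symmetric]) measurable
  also have "\<dots> = (\<integral>\<^sup>+u. ennreal P * ennreal (indicator {0<..} u * (u powr (b - 1) * (1 + u) powr (- (a + b)))) \<partial>lborel)"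
  proof (rule nn_integral_cong)
    fix u :: real
    show "(\<integral>\<^sup>+t. ?h t u \<partial>lborel) = ennreal P * ennreal (indicator {0<..} u * (u powr (b - 1) * (1 + u) powr (- (a + b))))"
    proof (cases "u > 0")
      case True
      have "(\<integral>\<^sup>+t. ?h t u \<partial>lborel) = (\<integral>\<^sup>+t. ennreal (u powr (b - 1)) * ennreal (?m t * exp (- ((1 + u) * (norm t)\<^sup>2))) \<partial>lborel)"
        using True by (intro nn_integral_cong) (simp add: ennreal_mult'[symmetric] mult_ac)
      also have "\<dots> = ennreal (u powr (b - 1)) * (\<integral>\<^sup>+t. ennreal (?m t * exp (- ((1 + u) * (norm t)\<^sup>2))) \<partial>lborel)"
        by (rule nn_integral_cmult) measurable
      also have "\<dots> = ennreal (u powr (b - 1)) * ennreal (P * (1 + u) powr (- (a + b)))"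
        using True by (subst nn_integral_gaussian_monomial) (simp_all add: P_def ab i)
      finally show ?thesis using True P by (simp add: ennreal_mult'[symmetric] mult_ac)
    qed simp
  qed
  also have "\<dots> = ennreal P * ennreal (Gamma a * Gamma b / Gamma (a + b))"
    by (subst nn_integral_cmult) (measurable, simp only: nn_integral_beta_kernel[OF a b])
  also have "\<dots> = ennreal (Gamma b) * ennreal (P * (Gamma a / Gamma (a + b)))"
    using P G by (simp add: ennreal_mult'[symmetric] mult_ac)
  finally have "ennreal (Gamma b) * (\<integral>\<^sup>+t. ennreal (radial_weight t * ?m t) \<partial>lborel) =
     ennreal (Gamma b) * ennreal (P * (Gamma a / Gamma (a + b)))" .
  then show ?thesis
    using G by (simp add: ennreal_mult_cancel_left P_def ab) (simp add: a_def mult_ac)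
qed

text \<open>
  The value of \<open>\<integral> radial_weight s (s \<bullet> e)\<^sup>2\<^sup>k ds\<close> for a unit vector \<open>e\<close> of an \<open>n\<close>-dimensional
  space and \<open>k > 0\<close>.
\<close>

definition radial_moment_const :: "nat \<Rightarrow> nat \<Rightarrow> real" where
  "radial_moment_const n k =
     pi powr (real n / 2) * (Gamma (real k - 1/2) / Gamma (real n / 2 + real k)) * pochhammer (1/2) k"

lemma radial_moment_const_pos:
  assumes "k > 0"
  shows "radial_moment_const n k > 0"
  unfolding radial_moment_const_def using assms
  by (intro mult_pos_pos divide_pos_pos Gamma_real_pos pochhammer_pos) (auto simp: add_nonneg_pos)

text \<open>
  In an orthonormal eigenbasis of \<open>A\<close> the form is \<open>\<Sum>j. d j * (x $ j)\<^sup>2\<close>.  The multinomial expansion of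
  its \<open>k\<close>-th power pairs each monomial in the \<open>d j\<close> with the moment
  \<open>\<Prod>j. pochhammer (1/2) (i j)\<close>, and this is how the zonal polynomial of \<open>(k)\<close> arises.
\<close>

lemma nn_integral_radial_weight_quadratic_form:
  fixes A Q :: "real^'n^'n"
  assumes Q: "orthogonal_matrix Q" and A: "A = Q ** diagonal_matrix d ** transpose Q"
    and d: "\<And>j. d j \<ge> 0" and k: "k > 0"
  shows "(\<integral>\<^sup>+t. ennreal (radial_weight t * (t \<bullet> (A *v t)) ^ k) \<partial>lborel) =
    ennreal (radial_moment_const CARD('n) k * zonal k A)"
proof -
  let ?I = "{i :: 'n \<Rightarrow> nat. (\<Sum>j\<in>UNIV. i j) = k}"
  define c where "c i = fact k * (\<Prod>j\<in>UNIV. d j ^ i j / fact (i j))" for i :: "'n \<Rightarrow> nat"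
  define K where "K = pi powr (real CARD('n) / 2) * (Gamma (real k - 1/2) / Gamma (real CARD('n) / 2 + real k))"
  have c: "c i \<ge> 0" for i using d by (auto simp: c_def intro!: mult_nonneg_nonneg prod_nonneg)
  have K: "K \<ge> 0" unfolding K_def using k
    by (intro mult_nonneg_nonneg divide_nonneg_nonneg less_imp_le[OF Gamma_real_pos]) (auto simp: add_nonneg_pos)
  have pos: "pochhammer (1/2 :: real) m > 0" for m by (rule pochhammer_pos) simp
  have expand: "radial_weight (Q *v x) * ((Q *v x) \<bullet> (A *v (Q *v x))) ^ k =
     (\<Sum>i\<in>?I. c i * (radial_weight x * (\<Prod>j\<in>UNIV. (x $ j) ^ (2 * i j))))" for x
  proof -
    have "((Q *v x) \<bullet> (A *v (Q *v x))) ^ k = (\<Sum>j\<in>UNIV. d j * (x $ j)\<^sup>2) ^ k"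
      unfolding A diagonalized_quadratic_form by (simp add: orthogonal_matrix_norm[OF Q] del: transpose_matrix_vector)
    also have "\<dots> = (\<Sum>i\<in>?I. c i * (\<Prod>j\<in>UNIV. (x $ j) ^ (2 * i j)))"
      unfolding multinomial_theorem sum_distrib_left c_def
      by (intro sum.cong refl) (simp add: prod.distrib[symmetric] power_mult_distrib power_mult)
    finally show ?thesis
      by (simp add: radial_weight_def orthogonal_matrix_norm[OF Q] sum_distrib_left mult_ac)
  qed
  have m: "(\<Prod>j\<in>UNIV. (x $ j) ^ (2 * i j)) \<ge> 0" for x :: "real^'n" and i :: "'n \<Rightarrow> nat"
    by (intro prod_nonneg) (auto simp: power_mult)
  have "(\<integral>\<^sup>+t. ennreal (radial_weight t * (t \<bullet> (A *v t)) ^ k) \<partial>lborel) =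
    (\<integral>\<^sup>+x. ennreal (radial_weight (Q *v x) * ((Q *v x) \<bullet> (A *v (Q *v x))) ^ k) \<partial>lborel)"
    by (rule nn_integral_lborel_orthogonal[OF Q, symmetric]) measurable
  also have "\<dots> = (\<integral>\<^sup>+x. (\<Sum>i\<in>?I. ennreal (c i) * ennreal (radial_weight x * (\<Prod>j\<in>UNIV. (x $ j) ^ (2 * i j)))) \<partial>lborel)"
    unfolding expand
    by (subst sum_ennreal[symmetric]) (auto intro!: mult_nonneg_nonneg c m simp: ennreal_mult' c)
  also have "\<dots> = (\<Sum>i\<in>?I. ennreal (c i) * (\<integral>\<^sup>+x. ennreal (radial_weight x * (\<Prod>j\<in>UNIV. (x $ j) ^ (2 * i j))) \<partial>lborel))"
    by (subst nn_integral_sum) (measurable, intro sum.cong refl nn_integral_cmult, measurable)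
  also have "\<dots> = (\<Sum>i\<in>?I. ennreal (c i * (K * (\<Prod>j\<in>UNIV. pochhammer (1/2) (i j)))))"
    using k by (intro sum.cong refl) (simp add: nn_integral_radial_weight_monomial K_def ennreal_mult'[symmetric] c)
  also have "\<dots> = ennreal (\<Sum>i\<in>?I. c i * (K * (\<Prod>j\<in>UNIV. pochhammer (1/2) (i j))))"
    by (intro sum_ennreal mult_nonneg_nonneg c K prod_nonneg ballI less_imp_le[OF pos])
  also have "(\<Sum>i\<in>?I. c i * (K * (\<Prod>j\<in>UNIV. pochhammer (1/2) (i j)))) =
     K * (fact k * (\<Sum>i\<in>?I. \<Prod>j\<in>UNIV. pochhammer (1/2) (i j) * d j ^ i j / fact (i j)))"
    unfolding sum_distrib_left c_def
    by (intro sum.cong refl) (simp add: prod.distrib[symmetric] mult_ac flip: mult.assoc)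
  also have "\<dots> = radial_moment_const CARD('n) k * zonal k A"
    unfolding zonal_diagonalized[OF Q A] radial_moment_const_def K_def using pos[of k] by simp
  finally show ?thesis .
qed

text \<open>
  A rotation takes \<open>v\<close> to a multiple of a coordinate vector, leaving a single monomial.
\<close>

lemma nn_integral_radial_weight_linear_form:
  fixes v :: "real^'n"
  assumes k: "k > 0"
  shows "(\<integral>\<^sup>+s. ennreal (radial_weight s * (s \<bullet> v) ^ (2 * k)) \<partial>lborel) =
    ennreal (radial_moment_const CARD('n) k * (norm v)\<^sup>2 ^ k)"
proof (cases "v = 0")
  case True
  then show ?thesis using k by (simp add: power_0_left)
next
  case False
  obtain j0 :: 'n where True by blast
  have "norm ((1 / norm v) *\<^sub>R v) = 1" using False by simp
  then obtain Q where Q: "orthogonal_matrix Q" "Q *v axis j0 1 = (1 / norm v) *\<^sub>R v"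
    using orthogonal_matrix_exists_basis by metis
  have v: "v = norm v *\<^sub>R (Q *v axis j0 1)"
    using False by (simp only: Q) simp
  have inner: "(Q *v x) \<bullet> v = norm v * x $ j0" for x
  proof -
    have "(Q *v x) \<bullet> v = norm v * ((Q *v x) \<bullet> (Q *v axis j0 1))"
      by (subst v) simp
    then show ?thesis by (simp only: orthogonal_matrix_inner[OF Q(1)]) (simp add: inner_axis)
  qed
  define i where "i = (\<lambda>j. if j = j0 then k else 0)"
  have i: "(\<Sum>j\<in>UNIV. i j) = k" by (simp add: i_def)
  have mon: "(x $ j0) ^ (2 * k) = (\<Prod>j\<in>UNIV. (x $ j) ^ (2 * i j))" for x :: "real^'n"
  proof -
    have "(\<Prod>j\<in>UNIV. (x $ j) ^ (2 * i j)) = (\<Prod>j\<in>UNIV. if j = j0 then (x $ j) ^ (2 * k) else 1)"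
      by (rule prod.cong) (auto simp: i_def)
    then show ?thesis by simp
  qed
  have poch: "(\<Prod>j\<in>UNIV. pochhammer (1/2 :: real) (i j)) = pochhammer (1/2) k"
  proof -
    have "(\<Prod>j\<in>UNIV. pochhammer (1/2 :: real) (i j)) = (\<Prod>j\<in>UNIV. if j = j0 then pochhammer (1/2) k else 1)"
      by (rule prod.cong) (auto simp: i_def)
    then show ?thesis by simp
  qed
  have "(\<integral>\<^sup>+s. ennreal (radial_weight s * (s \<bullet> v) ^ (2 * k)) \<partial>lborel) =
    (\<integral>\<^sup>+x. ennreal (radial_weight (Q *v x) * ((Q *v x) \<bullet> v) ^ (2 * k)) \<partial>lborel)"
    by (rule nn_integral_lborel_orthogonal[OF Q(1), symmetric]) measurable
  also have "\<dots> = (\<integral>\<^sup>+x. ennreal (norm v ^ (2 * k)) * ennreal (radial_weight x * (\<Prod>j\<in>UNIV. (x $ j) ^ (2 * i j))) \<partial>lborel)"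
    unfolding inner mon[symmetric]
    by (intro nn_integral_cong)
      (simp add: radial_weight_def orthogonal_matrix_norm[OF Q(1)] ennreal_mult'[symmetric] power_mult_distrib mult_ac)
  also have "\<dots> = ennreal (norm v ^ (2 * k)) * (\<integral>\<^sup>+x. ennreal (radial_weight x * (\<Prod>j\<in>UNIV. (x $ j) ^ (2 * i j))) \<partial>lborel)"
    by (rule nn_integral_cmult) measurable
  also have "\<dots> = ennreal (norm v ^ (2 * k)) * ennreal (radial_moment_const CARD('n) k)"
    by (subst nn_integral_radial_weight_monomial[OF i k]) (simp add: radial_moment_const_def poch)
  also have "\<dots> = ennreal (radial_moment_const CARD('n) k * norm v ^ (2 * k))"
    by (subst ennreal_mult'[symmetric]) (simp_all only: zero_le_power norm_ge_zero mult.commute)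
  finally show ?thesis by (simp only: power_mult)
qed

section \<open>The dependence integral\<close>

text \<open>
  The sum is \<open>2 cosh (2 x) - 4 cosh x + 2\<close>, whose constant terms cancel.  All remaining coefficients
  are nonnegative, unlike those of \<open>(1 - exp (- x))\<^sup>2\<close> itself.
\<close>

lemma one_minus_exp_symmetrized_sums:
  fixes x :: real
  shows "(\<lambda>k. 2 * ((2 ^ (2 * Suc k) - 2) / fact (2 * Suc k)) * x ^ (2 * Suc k)) sums
    ((1 - exp (- x))\<^sup>2 + (1 - exp x)\<^sup>2)"
proof -
  have cosh: "(\<lambda>k. y ^ (2 * k) / fact (2 * k)) sums cosh y" for y :: real
  proof -
    have "(\<lambda>k. (\<lambda>n. if even n then y ^ n /\<^sub>R fact n else 0) (2 * k)) sums cosh y"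
      using cosh_converges[of y]
      by (subst sums_mono_reindex[where g = "\<lambda>k. 2 * k"]) (auto simp: strict_mono_def elim!: evenE)
    then show ?thesis by (simp add: divide_inverse mult.commute)
  qed
  \<comment> \<open>Both series start at \<open>k = 0\<close>; the common term there is \<open>2 - 4 = - 2\<close> and is split off below.\<close>
  have "(\<lambda>k. 2 * ((2 * x) ^ (2 * k) / fact (2 * k)) - 4 * (x ^ (2 * k) / fact (2 * k))) sums (2 * cosh (2 * x) - 4 * cosh x)"
    by (intro sums_diff sums_mult cosh)
  then have "(\<lambda>k. 2 * ((2 ^ (2 * k) - 2) / fact (2 * k)) * x ^ (2 * k)) sums (2 * cosh (2 * x) - 4 * cosh x)"
    by (simp add: power_mult_distrib field_simps)
  then have "(\<lambda>k. 2 * ((2 ^ (2 * Suc k) - 2) / fact (2 * Suc k)) * x ^ (2 * Suc k)) sums (2 * cosh (2 * x) - 4 * cosh x + 2)"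
    by (subst sums_Suc_iff) simp
  also have "2 * cosh (2 * x) - 4 * cosh x + 2 = (1 - exp (- x))\<^sup>2 + (1 - exp x)\<^sup>2"
    by (simp add: cosh_def power2_eq_square algebra_simps exp_add[symmetric])
  finally show ?thesis .
qed

lemma dependence_coeff_nonneg: "(2 ^ (2 * Suc k) - 2) / fact (2 * Suc k) \<ge> (0 :: real)"
proof -
  have "(2 :: real) ^ 1 \<le> 2 ^ (2 * Suc k)" by (rule power_increasing) simp_all
  then show ?thesis by simp
qed

text \<open>
  The weight is even, so the integrand may be averaged over \<open>s\<close> and \<open>- s\<close>.  Its expansion then has
  nonnegative terms and can be integrated term by term without any convergence argument.  To stay
  within nonnegative extended reals, twice the integral is computed.
\<close>

lemma nn_integral_dependence_inner:
  fixes v :: "real^'p"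
  shows "(\<integral>\<^sup>+s. ennreal (radial_weight s * (1 - exp (- (s \<bullet> v)))\<^sup>2) \<partial>lborel) =
    (\<Sum>k. ennreal ((2 ^ (2 * Suc k) - 2) / fact (2 * Suc k) * radial_moment_const CARD('p) (Suc k) * (norm v)\<^sup>2 ^ Suc k))"
    (is "?L = (\<Sum>k. ennreal (?c k))")
proof -
  define a :: "nat \<Rightarrow> real" where "a k = (2 ^ (2 * Suc k) - 2) / fact (2 * Suc k)" for k
  have a: "a k \<ge> 0" for k unfolding a_def by (rule dependence_coeff_nonneg)
  let ?f = "\<lambda>s :: real^'p. ennreal (radial_weight s * (1 - exp (- (s \<bullet> v)))\<^sup>2)"
  have "2 * ?L = ?L + ?L" by (simp add: mult_2)
  also have "\<dots> = (\<integral>\<^sup>+s. ?f s \<partial>lborel) + (\<integral>\<^sup>+s. ?f (- s) \<partial>lborel)"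
    by (subst nn_integral_lborel_uminus) simp_all
  also have "\<dots> = (\<integral>\<^sup>+s. ?f s + ?f (- s) \<partial>lborel)"
    by (rule nn_integral_add[symmetric]) measurable
  also have "\<dots> = (\<integral>\<^sup>+s. (\<Sum>k. ennreal (2 * a k) * ennreal (radial_weight s * (s \<bullet> v) ^ (2 * Suc k))) \<partial>lborel)"
  proof (rule nn_integral_cong)
    fix s :: "real^'p"
    have sums: "(\<lambda>k. radial_weight s * (2 * a k * (s \<bullet> v) ^ (2 * Suc k))) sums
      (radial_weight s * ((1 - exp (- (s \<bullet> v)))\<^sup>2 + (1 - exp (s \<bullet> v))\<^sup>2))"
      unfolding a_def by (intro sums_mult one_minus_exp_symmetrized_sums)
    have nn: "0 \<le> radial_weight s * (2 * a k * (s \<bullet> v) ^ (2 * Suc k))" for k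
      using a[of k] by (intro mult_nonneg_nonneg zero_le_even_power) simp_all
    have "?f s + ?f (- s) = ennreal (radial_weight s * ((1 - exp (- (s \<bullet> v)))\<^sup>2 + (1 - exp (s \<bullet> v))\<^sup>2))"
      by (simp add: ennreal_plus[symmetric] radial_weight_def distrib_left del: ennreal_plus)
    also have "\<dots> = (\<Sum>k. ennreal (radial_weight s * (2 * a k * (s \<bullet> v) ^ (2 * Suc k))))"
      using suminf_ennreal2[OF nn sums_summable[OF sums]] sums_unique[OF sums] by simp
    also have "\<dots> = (\<Sum>k. ennreal (2 * a k) * ennreal (radial_weight s * (s \<bullet> v) ^ (2 * Suc k)))"
      using a by (intro suminf_cong) (simp add: ennreal_mult'[symmetric] mult_ac)
    finally show "?f s + ?f (- s) = (\<Sum>k. ennreal (2 * a k) * ennreal (radial_weight s * (s \<bullet> v) ^ (2 * Suc k)))" .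
  qed
  also have "\<dots> = (\<Sum>k. \<integral>\<^sup>+s. ennreal (2 * a k) * ennreal (radial_weight s * (s \<bullet> v) ^ (2 * Suc k)) \<partial>lborel)"
    by (rule nn_integral_suminf) measurable
  also have "\<dots> = (\<Sum>k. 2 * ennreal (?c k))"
  proof (rule suminf_cong)
    fix k
    have "(\<integral>\<^sup>+s. ennreal (2 * a k) * ennreal (radial_weight s * (s \<bullet> v) ^ (2 * Suc k)) \<partial>lborel) =
      ennreal (2 * a k) * (\<integral>\<^sup>+s. ennreal (radial_weight s * (s \<bullet> v) ^ (2 * Suc k)) \<partial>lborel)"
      by (rule nn_integral_cmult) measurable
    also have "\<dots> = ennreal (2 * a k) * ennreal (radial_moment_const CARD('p) (Suc k) * (norm v)\<^sup>2 ^ Suc k)"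
      by (subst nn_integral_radial_weight_linear_form) simp_all
    also have "\<dots> = ennreal (2 * ?c k)"
      using a[of k] unfolding a_def[symmetric] by (subst ennreal_mult'[symmetric]) (simp_all only: zero_le_mult_iff mult_ac, simp_all)
    also have "\<dots> = 2 * ennreal (?c k)"
      by (subst ennreal_mult') simp_all
    finally show "(\<integral>\<^sup>+s. ennreal (2 * a k) * ennreal (radial_weight s * (s \<bullet> v) ^ (2 * Suc k)) \<partial>lborel) = 2 * ennreal (?c k)" .
  qed
  also have "\<dots> = 2 * (\<Sum>k. ennreal (?c k))" by simp
  finally show ?thesis by (simp add: ennreal_mult_cancel_left)
qed

text \<open>
  After integration over \<open>s\<close> the term of degree \<open>2k\<close> contains the power \<open>(norm (A *v t))\<^sup>2\<^sup>k\<close>, which is the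
  \<open>k\<close>-th power of the quadratic form of \<open>A\<^sup>T A\<close>.  The identity holds in the nonnegative extended
  reals, so convergence of the series will give integrability.
\<close>

lemma nn_integral_dependence:
  fixes A :: "real^'q^'p" and Q :: "real^'q^'q"
  assumes Q: "orthogonal_matrix Q" and L: "transpose A ** A = Q ** diagonal_matrix d ** transpose Q"
    and d: "\<And>j. d j \<ge> 0"
  shows "(\<integral>\<^sup>+z. ennreal (radial_weight (fst z) * radial_weight (snd z) * (1 - exp (- (fst z \<bullet> (A *v snd z))))\<^sup>2) \<partial>lborel) =
    (\<Sum>k. ennreal ((2 ^ (2 * Suc k) - 2) / fact (2 * Suc k) * radial_moment_const CARD('p) (Suc k) *
       radial_moment_const CARD('q) (Suc k) * zonal (Suc k) (transpose A ** A)))"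
proof -
  let ?f = "\<lambda>z :: (real^'p) \<times> (real^'q). ennreal (radial_weight (fst z) * radial_weight (snd z) * (1 - exp (- (fst z \<bullet> (A *v snd z))))\<^sup>2)"
  define b :: "nat \<Rightarrow> real" where "b k = (2 ^ (2 * Suc k) - 2) / fact (2 * Suc k) * radial_moment_const CARD('p) (Suc k)" for k
  have b: "b k \<ge> 0" for k
    unfolding b_def by (intro mult_nonneg_nonneg dependence_coeff_nonneg less_imp_le radial_moment_const_pos) simp
  have quad: "(norm (A *v t))\<^sup>2 = t \<bullet> ((transpose A ** A) *v t)" for t
    unfolding power2_norm_eq_inner
    by (metis dot_lmul_matrix inner_commute matrix_vector_mul_assoc transpose_matrix_vector)
  have "(\<integral>\<^sup>+z. ?f z \<partial>lborel) = (\<integral>\<^sup>+z. ?f z \<partial>(lborel \<Otimes>\<^sub>M lborel))"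
    by (simp add: lborel_prod)
  also have "\<dots> = (\<integral>\<^sup>+t. \<integral>\<^sup>+s. ?f (s, t) \<partial>lborel \<partial>lborel)"
    by (rule lborel_pair.nn_integral_snd[symmetric]) measurable
  also have "\<dots> = (\<integral>\<^sup>+t. (\<Sum>k. ennreal (b k) * ennreal (radial_weight t * (t \<bullet> ((transpose A ** A) *v t)) ^ Suc k)) \<partial>lborel)"
  proof (rule nn_integral_cong)
    fix t :: "real^'q"
    have "(\<integral>\<^sup>+s. ?f (s, t) \<partial>lborel) =
      (\<integral>\<^sup>+s. ennreal (radial_weight t) * ennreal (radial_weight s * (1 - exp (- (s \<bullet> (A *v t))))\<^sup>2) \<partial>lborel)"
      by (intro nn_integral_cong) (simp add: ennreal_mult'[symmetric] mult_ac)
    also have "\<dots> = ennreal (radial_weight t) * (\<integral>\<^sup>+s. ennreal (radial_weight s * (1 - exp (- (s \<bullet> (A *v t))))\<^sup>2) \<partial>lborel)"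
      by (rule nn_integral_cmult) measurable
    also have "\<dots> = (\<Sum>k. ennreal (radial_weight t) * ennreal (b k * (norm (A *v t))\<^sup>2 ^ Suc k))"
      unfolding nn_integral_dependence_inner b_def by simp
    also have "\<dots> = (\<Sum>k. ennreal (b k) * ennreal (radial_weight t * (t \<bullet> ((transpose A ** A) *v t)) ^ Suc k))"
      using b by (intro suminf_cong) (simp add: ennreal_mult'[symmetric] mult_ac quad)
    finally show "(\<integral>\<^sup>+s. ?f (s, t) \<partial>lborel) = \<dots>" .
  qed
  also have "\<dots> = (\<Sum>k. \<integral>\<^sup>+t. ennreal (b k) * ennreal (radial_weight t * (t \<bullet> ((transpose A ** A) *v t)) ^ Suc k) \<partial>lborel)"
    by (rule nn_integral_suminf) measurable
  also have "\<dots> = (\<Sum>k. ennreal (b k * radial_moment_const CARD('q) (Suc k) * zonal (Suc k) (transpose A ** A)))"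
  proof (rule suminf_cong)
    fix k
    have "(\<integral>\<^sup>+t. ennreal (b k) * ennreal (radial_weight t * (t \<bullet> ((transpose A ** A) *v t)) ^ Suc k) \<partial>lborel) =
      ennreal (b k) * (\<integral>\<^sup>+t. ennreal (radial_weight t * (t \<bullet> ((transpose A ** A) *v t)) ^ Suc k) \<partial>lborel)"
      by (rule nn_integral_cmult) measurable
    also have "\<dots> = ennreal (b k) * ennreal (radial_moment_const CARD('q) (Suc k) * zonal (Suc k) (transpose A ** A))"
      by (subst nn_integral_radial_weight_quadratic_form[OF Q L d]) simp_all
    finally show "(\<integral>\<^sup>+t. ennreal (b k) * ennreal (radial_weight t * (t \<bullet> ((transpose A ** A) *v t)) ^ Suc k) \<partial>lborel) =
      ennreal (b k * radial_moment_const CARD('q) (Suc k) * zonal (Suc k) (transpose A ** A))"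
      using b by (simp add: ennreal_mult'[symmetric] mult.assoc)
  qed
  finally show ?thesis by (simp only: b_def)
qed

section \<open>Characteristic functions of normal vectors\<close>

text \<open>
  A point mass is a normal law of variance zero; after this lemma the degenerate case needs no
  separate treatment.
\<close>

lemma (in prob_space) normal_or_const_moments:
  fixes W :: "'a \<Rightarrow> real"
  assumes W[measurable]: "W \<in> borel_measurable M"
    and normal: "(\<exists>m. AE w in M. W w = m) \<or> (\<exists>m \<sigma>. \<sigma> > 0 \<and> distributed M lborel W (normal_density m \<sigma>))"
  shows "integrable M W" "integrable M (\<lambda>w. (W w - c)\<^sup>2)"
    and "(CLINT w|M. exp (\<i> * complex_of_real (W w))) = cis (expectation W) * exp (- (variance W) / 2)"
proof -
  consider (const) m where "AE w in M. W w = m"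
    | (density) m \<sigma> where "\<sigma> > 0" "distributed M lborel W (normal_density m \<sigma>)"
    using normal by blast
  then have "integrable M W \<and> integrable M (\<lambda>w. (W w - c)\<^sup>2) \<and>
    (CLINT w|M. exp (\<i> * complex_of_real (W w))) = cis (expectation W) * exp (- (variance W) / 2)"
  proof cases
    case const
    have "integrable M W"
      using const by (subst integrable_cong_AE[where g = "\<lambda>_. m"]) auto
    moreover have "integrable M (\<lambda>w. (W w - c)\<^sup>2)"
      using const by (subst integrable_cong_AE[where g = "\<lambda>_. (m - c)\<^sup>2"]) auto
    moreover have E: "expectation W = m"
      using const by (subst integral_cong_AE[where g = "\<lambda>_. m"]) (auto simp: prob_space)
    moreover have "variance W = 0"
      unfolding E using const by (subst integral_cong_AE[where g = "\<lambda>_. 0"]) auto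
    moreover have "(CLINT w|M. exp (\<i> * complex_of_real (W w))) = (CLINT w|M. cis m)"
      using const by (intro integral_cong_AE) (auto simp: cis_conv_exp)
    ultimately show ?thesis by (simp add: prob_space)
  next
    case density
    note D = density(2) and \<sigma> = density(1)
    have E: "expectation W = m" by (rule normal_distributed_expectation[OF \<sigma> D])
    have V: "variance W = \<sigma>\<^sup>2" by (rule normal_distributed_variance[OF \<sigma> D])
    have int: "integrable M (\<lambda>w. (W w - m) ^ k)" for k
      by (subst distributed_integrable[OF D, symmetric]) (auto intro!: integrable_normal_moment \<sigma>)
    have "integrable M (\<lambda>w. (W w - m) + m)" using int[of 1] by (intro Bochner_Integration.integrable_add) auto
    then have intW: "integrable M W" by simp
    have "integrable M (\<lambda>w. (W w - m)\<^sup>2 + 2 * (m - c) * (W w - m) + (m - c)\<^sup>2)"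
      using int[of 2] int[of 1] by (intro Bochner_Integration.integrable_add integrable_mult_right) auto
    then have "integrable M (\<lambda>w. (W w - c)\<^sup>2)"
      by (rule Bochner_Integration.integrable_cong[THEN iffD1, rotated -1]) (auto simp: power2_eq_square algebra_simps)
    define N where "N w = (W w - m) / \<sigma>" for w
    have [measurable]: "N \<in> borel_measurable M" by (simp add: N_def[abs_def])
    have "distributed M lborel N std_normal_density"
      using D normal_standard_normal_convert[OF \<sigma>] by (simp add: N_def[abs_def])
    then have N: "distr M lborel N = std_normal_distribution"
      by (rule distributed_distr_eq_density)
    have "W w = m + \<sigma> * N w" for w using \<sigma> by (simp add: N_def)
    then have "(CLINT w|M. exp (\<i> * complex_of_real (W w))) = (CLINT w|M. cis m * iexp (\<sigma> * N w))"
      by (simp add: cis_conv_exp exp_add[symmetric] distrib_left)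
    also have "\<dots> = cis m * (CLINT w|M. iexp (\<sigma> * N w))" by simp
    also have "(CLINT w|M. iexp (\<sigma> * N w)) = (CLINT x|distr M lborel N. iexp (\<sigma> * x))"
      by (subst integral_distr) simp_all
    also have "\<dots> = char std_normal_distribution \<sigma>"
      unfolding N char_def ..
    also have "\<dots> = exp (- (\<sigma>\<^sup>2) / 2)"
      by (simp add: char_std_normal_distribution)
    finally show ?thesis using intW \<open>integrable M (\<lambda>w. (W w - c)\<^sup>2)\<close> by (simp add: E V[unfolded E])
  qed
  then show "integrable M W" "integrable M (\<lambda>w. (W w - c)\<^sup>2)"
    "(CLINT w|M. exp (\<i> * complex_of_real (W w))) = cis (expectation W) * exp (- (variance W) / 2)"
    by blast+
qed

text \<open>
  Everything is inherited from the univariate laws of the functionals \<open>u \<bullet> Z\<close>.  Only the passage from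
  the covariance matrix to the variance of \<open>u \<bullet> Z\<close> needs the products of two coordinates to be
  integrable, which follows by polarization.
\<close>

lemma (in prob_space) multivariate_normal_char:
  fixes Z :: "'a \<Rightarrow> real^'n"
  assumes Z: "multivariate_normal M Z \<mu> S"
  shows "(CLINT w|M. exp (\<i> * complex_of_real (u \<bullet> Z w))) = cis (u \<bullet> \<mu>) * exp (- (u \<bullet> (S *v u)) / 2)"
    and "0 \<le> u \<bullet> (S *v u)"
proof -
  have Zm[measurable]: "Z \<in> borel_measurable M" using Z by (simp add: multivariate_normal_def)
  have meas: "(\<lambda>w. v \<bullet> Z w) \<in> borel_measurable M" for v by measurable
  have normal: "(\<exists>m. AE w in M. v \<bullet> Z w = m) \<or>
    (\<exists>m \<sigma>. \<sigma> > 0 \<and> distributed M lborel (\<lambda>w. v \<bullet> Z w) (normal_density m \<sigma>))" for v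
    using Z unfolding multivariate_normal_def by blast
  note mom = normal_or_const_moments[OF meas normal]
  have \<mu>: "\<mu> $ i = expectation (\<lambda>w. Z w $ i)" and S: "S $ i $ j = expectation (\<lambda>w. (Z w $ i - \<mu> $ i) * (Z w $ j - \<mu> $ j))"
    for i j using Z by (auto simp: multivariate_normal_def mean_vec_def cov_matrix_def)
  have int1: "integrable M (\<lambda>w. Z w $ i)" for i
    using mom(1)[of "axis i 1"] by (simp add: inner_axis' )
  have E: "expectation (\<lambda>w. v \<bullet> Z w) = v \<bullet> \<mu>" for v
    by (simp add: inner_vec_def \<mu> int1)
  have sq: "integrable M (\<lambda>w. (v \<bullet> (Z w - \<mu>))\<^sup>2)" for v
    using mom(2)[of v "v \<bullet> \<mu>"] by (simp add: inner_diff_right)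
  have int2: "integrable M (\<lambda>w. (Z w $ i - \<mu> $ i) * (Z w $ j - \<mu> $ j))" for i j
  proof -
    have "integrable M (\<lambda>w. (((axis i 1 + axis j 1) \<bullet> (Z w - \<mu>))\<^sup>2 - (axis i 1 \<bullet> (Z w - \<mu>))\<^sup>2 - (axis j 1 \<bullet> (Z w - \<mu>))\<^sup>2) / 2)"
      by (intro integrable_divide Bochner_Integration.integrable_diff sq)
    then show ?thesis
      by (rule Bochner_Integration.integrable_cong[THEN iffD1, rotated -1])
        (auto simp: inner_add_left inner_axis' power2_eq_square field_simps)
  qed
  have V: "variance (\<lambda>w. u \<bullet> Z w) = u \<bullet> (S *v u)"
  proof -
    have "(u \<bullet> Z w - u \<bullet> \<mu>)\<^sup>2 = (\<Sum>i\<in>UNIV. \<Sum>j\<in>UNIV. u $ i * u $ j * ((Z w $ i - \<mu> $ i) * (Z w $ j - \<mu> $ j)))" for w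
    proof -
      have "u \<bullet> Z w - u \<bullet> \<mu> = (\<Sum>i\<in>UNIV. u $ i * (Z w $ i - \<mu> $ i))"
        by (simp add: inner_vec_def sum_subtractf right_diff_distrib)
      then show ?thesis
        unfolding power2_eq_square by (simp add: sum_product mult_ac)
    qed
    then have "variance (\<lambda>w. u \<bullet> Z w) = (\<Sum>i\<in>UNIV. \<Sum>j\<in>UNIV. u $ i * u $ j * S $ i $ j)"
      unfolding E by (simp add: int2 S)
    also have "\<dots> = u \<bullet> (S *v u)"
      by (simp add: inner_vec_def matrix_vector_mult_def sum_distrib_left mult_ac)
    finally show ?thesis .
  qed
  show "(CLINT w|M. exp (\<i> * complex_of_real (u \<bullet> Z w))) = cis (u \<bullet> \<mu>) * exp (- (u \<bullet> (S *v u)) / 2)"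
    using mom(3)[of u] by (simp add: E V[unfolded E])
  have "0 \<le> variance (\<lambda>w. u \<bullet> Z w)" by simp
  then show "0 \<le> u \<bullet> (S *v u)" by (simp only: V)
qed

lemma inner_join_vec: "join_vec a b \<bullet> join_vec x y = a \<bullet> x + b \<bullet> y"
  for a x :: "real^'p" and b y :: "real^'q"
  by (simp add: inner_vec_def join_vec_def UNIV_Plus_UNIV[symmetric] sum.Plus del: UNIV_Plus_UNIV)

lemma block_matrix_join_vec:
  "block_matrix A B C D *v join_vec x y = join_vec (A *v x + B *v y) (C *v x + D *v y)"
  by (simp add: vec_eq_iff matrix_vector_mult_def block_matrix_def join_vec_def
      UNIV_Plus_UNIV[symmetric] sum.Plus del: UNIV_Plus_UNIV split: sum.split)

lemma join_vec_eq_sum: "u \<bullet> join_vec a b = u \<bullet> join_vec a 0 + u \<bullet> join_vec 0 b"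
  by (simp add: inner_vec_def join_vec_def UNIV_Plus_UNIV[symmetric] sum.Plus del: UNIV_Plus_UNIV)

lemma cov_matrix_join_vec:
  assumes "cov_matrix M (\<lambda>w. join_vec (X w) (Y w)) = block_matrix A B C D"
  shows "cov_matrix M X = A" "cov_matrix M Y = D"
    and "transpose A = A" "transpose D = D"
proof -
  have eq: "cov_matrix M (\<lambda>w. join_vec (X w) (Y w)) $ i $ j = block_matrix A B C D $ i $ j" for i j
    using assms by simp
  show A: "cov_matrix M X = A" 
    using eq[of "Inl _" "Inl _"] by (simp add: cov_matrix_def mean_vec_def block_matrix_def join_vec_def vec_eq_iff)
  show D: "cov_matrix M Y = D"
    using eq[of "Inr _" "Inr _"] by (simp add: cov_matrix_def mean_vec_def block_matrix_def join_vec_def vec_eq_iff)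
  show "transpose A = A" "transpose D = D"
    unfolding A[symmetric] D[symmetric] by (simp_all add: cov_matrix_def transpose_def vec_eq_iff mult.commute)
qed

lemma transpose_inner: "(transpose A *v x) \<bullet> y = x \<bullet> (A *v y)"
  for A :: "real^'n^'m"
  by (simp add: dot_lmul_matrix)

lemma symmetric_conjugate_inner:
  fixes B :: "real^'n^'n"
  assumes "transpose B = B"
  shows "(B *v x) \<bullet> y = x \<bullet> (B *v y)"
  using transpose_inner[of B x y] assms by simp

lemma (in prob_space) joint_char_normal:
  fixes X :: "'a \<Rightarrow> real^'p" and Y :: "'a \<Rightarrow> real^'q"
  assumes Z: "multivariate_normal M (\<lambda>w. join_vec (X w) (Y w)) \<mu>
    (block_matrix SX SXY (transpose SXY) SY)"
  shows "joint_char M X Y s t = cis (join_vec s 0 \<bullet> \<mu>) * cis (join_vec 0 t \<bullet> \<mu>) *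
      exp (- (s \<bullet> (SX *v s) + t \<bullet> (SY *v t) + 2 * (s \<bullet> (SXY *v t))) / 2)"
    and "0 \<le> s \<bullet> (SX *v s) + t \<bullet> (SY *v t) + 2 * (s \<bullet> (SXY *v t))"
proof -
  have quad: "join_vec s t \<bullet> (block_matrix SX SXY (transpose SXY) SY *v join_vec s t) =
    s \<bullet> (SX *v s) + t \<bullet> (SY *v t) + 2 * (s \<bullet> (SXY *v t))"
    unfolding block_matrix_join_vec inner_join_vec
    by (simp add: inner_add_right transpose_inner inner_commute[of t] del: transpose_matrix_vector)
  have "joint_char M X Y s t = (CLINT w|M. exp (\<i> * complex_of_real (join_vec s t \<bullet> join_vec (X w) (Y w))))"
    by (simp add: joint_char_def inner_join_vec algebra_simps)
  also have "\<dots> = cis (join_vec s t \<bullet> \<mu>) * exp (- (s \<bullet> (SX *v s) + t \<bullet> (SY *v t) + 2 * (s \<bullet> (SXY *v t))) / 2)"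
    by (simp only: multivariate_normal_char(1)[OF Z] quad)
  also have "join_vec s t \<bullet> \<mu> = join_vec s 0 \<bullet> \<mu> + join_vec 0 t \<bullet> \<mu>"
    using join_vec_eq_sum[of \<mu> s t] by (simp add: inner_commute)
  finally show "joint_char M X Y s t = cis (join_vec s 0 \<bullet> \<mu>) * cis (join_vec 0 t \<bullet> \<mu>) *
      exp (- (s \<bullet> (SX *v s) + t \<bullet> (SY *v t) + 2 * (s \<bullet> (SXY *v t))) / 2)"
    by (simp add: cis_mult)
  show "0 \<le> s \<bullet> (SX *v s) + t \<bullet> (SY *v t) + 2 * (s \<bullet> (SXY *v t))"
    using multivariate_normal_char(2)[OF Z, of "join_vec s t"] by (simp only: quad)
qed

text \<open>
  Standardization replaces both marginal covariances by the identity and the cross covariance by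
  \<open>A\<close>, so the characteristic functions differ from the product of the marginal ones only by the factor
  \<open>exp (- (s \<bullet> A t))\<close>.  That \<open>A\<close> is a contraction is the semidefiniteness of the standardized joint
  covariance matrix, tested at \<open>s = - A t\<close>.
\<close>

lemma (in prob_space) dcov_integrand_standardized_normal:
  fixes X :: "'a \<Rightarrow> real^'p" and Y :: "'a \<Rightarrow> real^'q"
  assumes Z: "multivariate_normal M (\<lambda>w. join_vec (X w) (Y w)) \<mu>
    (block_matrix SX SXY (transpose SXY) SY)"
    and inv: "invertible SX" "invertible SY"
  defines "A \<equiv> inv_sqrt SX ** SXY ** inv_sqrt SY"
  shows "dcov_integrand M (standardize M X) (standardize M Y) =
      (\<lambda>z. radial_weight (fst z) * radial_weight (snd z) * (1 - exp (- (fst z \<bullet> (A *v snd z))))\<^sup>2)"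
    and "norm (A *v t) \<le> norm t"
    and "inv_sqrt SY ** transpose SXY ** matrix_inv SX ** SXY ** inv_sqrt SY = transpose A ** A"
proof -
  define B where "B = inv_sqrt SX"
  define C where "C = inv_sqrt SY"
  have A: "A = B ** SXY ** C" by (simp add: A_def B_def C_def)
  have cov: "cov_matrix M (\<lambda>w. join_vec (X w) (Y w)) = block_matrix SX SXY (transpose SXY) SY"
    using Z by (simp add: multivariate_normal_def)
  note cov' = cov_matrix_join_vec[OF cov]
  have pdX: "positive_definite SX"
    using joint_char_normal(2)[OF Z, of _ 0]
    by (intro nonneg_form_invertible_imp_positive_definite cov' inv) simp
  have pdY: "positive_definite SY"
    using joint_char_normal(2)[OF Z, of 0]
    by (intro nonneg_form_invertible_imp_positive_definite cov' inv) simp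
  note X = inv_sqrt_positive_definite[OF pdX, folded B_def]
  note Y = inv_sqrt_positive_definite[OF pdY, folded C_def]
  have B: "transpose B = B" and C: "transpose C = C"
    using X Y by (simp_all add: positive_definite_def)
  note Bi = symmetric_conjugate_inner[OF B] and Ci = symmetric_conjugate_inner[OF C]
  have XX: "(B *v s) \<bullet> (SX *v (B *v s)) = (norm s)\<^sup>2" for s
  proof -
    have "B *v (SX *v (B *v s)) = s" using X(3) by (simp add: matrix_vector_mul_assoc matrix_mul_assoc)
    then show ?thesis by (simp add: Bi power2_norm_eq_inner)
  qed
  have YY: "(C *v t) \<bullet> (SY *v (C *v t)) = (norm t)\<^sup>2" for t
  proof -
    have "C *v (SY *v (C *v t)) = t" using Y(3) by (simp add: matrix_vector_mul_assoc matrix_mul_assoc)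
    then show ?thesis by (simp add: Ci power2_norm_eq_inner)
  qed
  have XY: "(B *v s) \<bullet> (SXY *v (C *v t)) = s \<bullet> (A *v t)" for s t
    by (simp add: Bi A matrix_vector_mul_assoc[symmetric])
  have Am: "norm (A *v t) \<le> norm t" for t
  proof -
    have "0 \<le> (norm (- (A *v t)))\<^sup>2 + (norm t)\<^sup>2 + 2 * ((- (A *v t)) \<bullet> (A *v t))"
      using joint_char_normal(2)[OF Z, of "B *v (- (A *v t))" "C *v t"] by (simp only: XX YY XY)
    then have "(norm (A *v t))\<^sup>2 \<le> (norm t)\<^sup>2" by (simp add: power2_norm_eq_inner)
    then show ?thesis by (simp add: power2_le_iff_abs_le)
  qed
  then show "norm (A *v t) \<le> norm t" .
  have std: "standardize M X = (\<lambda>w. B *v X w)" "standardize M Y = (\<lambda>w. C *v Y w)"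
    by (simp_all add: standardize_def cov' B_def C_def)
  have char: "joint_char M (standardize M X) (standardize M Y) s t =
    cis (join_vec (B *v s) 0 \<bullet> \<mu>) * cis (join_vec 0 (C *v t) \<bullet> \<mu>) *
      exp (- ((norm s)\<^sup>2 + (norm t)\<^sup>2 + 2 * (s \<bullet> (A *v t))) / 2)" for s t
  proof -
    have "joint_char M (standardize M X) (standardize M Y) s t = joint_char M X Y (B *v s) (C *v t)"
      by (simp add: joint_char_def std Bi Ci)
    then show ?thesis by (simp only: joint_char_normal(1)[OF Z] XX YY XY)
  qed
  have diff: "cmod (joint_char M (standardize M X) (standardize M Y) s t -
      joint_char M (standardize M X) (standardize M Y) s 0 * joint_char M (standardize M X) (standardize M Y) 0 t) ^ 2 =
      exp (- (norm s)\<^sup>2) * exp (- (norm t)\<^sup>2) * (1 - exp (- (s \<bullet> (A *v t))))\<^sup>2" for s t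
  proof -
    define a where "a = cis (join_vec (B *v s) 0 \<bullet> \<mu>)"
    define b where "b = cis (join_vec 0 (C *v t) \<bullet> \<mu>)"
    define es where "es = exp (- (norm s)\<^sup>2 / 2)"
    define et where "et = exp (- (norm t)\<^sup>2 / 2)"
    define ec where "ec = exp (- (s \<bullet> (A *v t)))"
    have split: "exp (- ((norm s)\<^sup>2 + (norm t)\<^sup>2 + 2 * (s \<bullet> (A *v t))) / 2) = es * et * ec"
      by (simp add: es_def et_def ec_def exp_add[symmetric] field_simps)
    have zero: "join_vec 0 0 = (0 :: real^('p + 'q))"
      by (simp add: join_vec_def vec_eq_iff split: sum.split)
    have s0: "joint_char M (standardize M X) (standardize M Y) s 0 = a * of_real es"
      and t0: "joint_char M (standardize M X) (standardize M Y) 0 t = b * of_real et"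
      unfolding char by (simp_all add: a_def b_def es_def et_def zero)
    have "joint_char M (standardize M X) (standardize M Y) s t -
      joint_char M (standardize M X) (standardize M Y) s 0 * joint_char M (standardize M X) (standardize M Y) 0 t =
      - (a * b * of_real (es * et * (1 - ec)))"
      unfolding s0 t0 unfolding char split a_def[symmetric] b_def[symmetric] by (simp add: algebra_simps)
    moreover have "cmod a = 1" "cmod b = 1" by (simp_all add: a_def b_def)
    ultimately have "cmod (joint_char M (standardize M X) (standardize M Y) s t -
      joint_char M (standardize M X) (standardize M Y) s 0 * joint_char M (standardize M X) (standardize M Y) 0 t) ^ 2 =
      (es * et * (1 - ec))\<^sup>2"
      by (simp only: norm_minus_cancel norm_mult norm_of_real mult_1_left power2_abs)
    also have "\<dots> = exp (- (norm s)\<^sup>2) * exp (- (norm t)\<^sup>2) * (1 - exp (- (s \<bullet> (A *v t))))\<^sup>2"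
      by (simp add: power_mult_distrib es_def et_def ec_def exp_double[symmetric])
    finally show ?thesis .
  qed
  show "dcov_integrand M (standardize M X) (standardize M Y) =
      (\<lambda>z. radial_weight (fst z) * radial_weight (snd z) * (1 - exp (- (fst z \<bullet> (A *v snd z))))\<^sup>2)"
    by (rule ext) (simp add: dcov_integrand_def diff radial_weight_def split: prod.split)
  have "transpose A = C ** transpose SXY ** B"
    by (simp add: A matrix_transpose_mul B C matrix_mul_assoc)
  then show "inv_sqrt SY ** transpose SXY ** matrix_inv SX ** SXY ** inv_sqrt SY = transpose A ** A"
    by (simp add: X(2)[symmetric] A C_def[symmetric] matrix_mul_assoc)
qed

section \<open>Summability and constants\<close>

text \<open>
  The binomial series of \<open>(1 - x) powr (1/2)\<close> at \<open>x = 1\<close>, which converges to \<open>0\<close>; its partial sums have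
  a closed form.
\<close>

lemma pochhammer_minus_half_telescope:
  "(\<Sum>k<n. - (pochhammer (-1/2) (Suc k) / fact (Suc k))) = 1 - pochhammer (1/2 :: real) n / fact n"
proof (induction n)
  case (Suc n)
  have "pochhammer (-1/2 :: real) (Suc n) = -1/2 * pochhammer (1/2) n"
    by (simp add: pochhammer_rec)
  moreover have "pochhammer (1/2 :: real) (Suc n) = pochhammer (1/2) n * (1/2 + real n)"
    by (rule pochhammer_Suc)
  moreover have "fact (Suc n) = (real n + 1) * fact n" by simp
  ultimately show ?case using Suc.IH
    by (simp only: sum.lessThan_Suc) (simp add: divide_simps, simp add: algebra_simps)
qed simp

lemma summable_pochhammer_minus_half:
  "summable (\<lambda>k. - (pochhammer (-1/2 :: real) (Suc k) / fact (Suc k)))"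
proof (rule summableI_nonneg_bounded[where x = 1])
  fix n :: nat
  have pos: "pochhammer (1/2 :: real) m > 0" for m by (rule pochhammer_pos) simp
  show "0 \<le> - (pochhammer (-1/2 :: real) (Suc n) / fact (Suc n))"
    using pos[of n] by (simp add: pochhammer_rec)
  show "(\<Sum>k<n. - (pochhammer (-1/2 :: real) (Suc k) / fact (Suc k))) \<le> 1"
    unfolding pochhammer_minus_half_telescope using pos[of n] by simp
qed

lemma pochhammer_minus_half_le:
  "(pochhammer (-1/2 :: real) (Suc k))\<^sup>2 \<le> pochhammer (1/2) (Suc k) * - pochhammer (-1/2) (Suc k)"
proof -
  have pos: "pochhammer (1/2 :: real) k > 0" by (rule pochhammer_pos) simp
  have eq: "pochhammer (-1/2 :: real) (Suc k) = - (pochhammer (1/2) k / 2)"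
    by (simp add: pochhammer_rec)
  have "pochhammer (1/2 :: real) k / 2 \<le> pochhammer (1/2) (Suc k)"
    using pos by (simp add: pochhammer_Suc field_simps)
  then have "(pochhammer (1/2) k / 2) * (pochhammer (1/2) k / 2) \<le> pochhammer (1/2 :: real) (Suc k) * (pochhammer (1/2) k / 2)"
    using pos by (intro mult_right_mono) simp_all
  then show ?thesis unfolding eq by (simp add: power2_eq_square)
qed

lemma pochhammer_mono:
  fixes a b :: real
  assumes "0 \<le> a" "a \<le> b"
  shows "pochhammer a k \<le> pochhammer b k"
  unfolding pochhammer_prod using assms by (intro prod_mono) auto

text \<open>
  The summand of the theorem, with the zonal polynomials abstracted to a sequence \<open>z\<close>.
\<close>

definition dcov_term :: "nat \<Rightarrow> nat \<Rightarrow> (nat \<Rightarrow> real) \<Rightarrow> nat \<Rightarrow> real" where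
  "dcov_term p q z k = (2 ^ (2 * k) - 2) / (fact k * 2 ^ (2 * k)) *
     (pochhammer (1/2) k * pochhammer (-1/2) k * pochhammer (-1/2) k /
       (pochhammer (real p / 2) k * pochhammer (real q / 2) k)) * z k"

text \<open>
  Inserting the bound on \<open>z\<close> cancels the Pochhammer symbols of \<open>q / 2\<close>.  Since \<open>p / 2 \<ge> 1 / 2\<close>, the
  factor \<open>pochhammer (-1/2) k / pochhammer (p/2) k\<close> is at most \<open>1\<close> in absolute value, and what is left
  is a term of the telescoping series.
\<close>

lemma dcov_term_bounds:
  assumes p: "p > 0" and q: "q > 0"
    and z: "0 \<le> z (Suc k)" "z (Suc k) \<le> pochhammer (real q / 2) (Suc k) / pochhammer (1/2) (Suc k)"
  shows "0 \<le> dcov_term p q z (Suc k)"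
    and "dcov_term p q z (Suc k) \<le> - (pochhammer (-1/2) (Suc k) / fact (Suc k))"
proof -
  define K where "K = Suc k"
  define m where "m = - pochhammer (-1/2 :: real) K"
  define h where "h = pochhammer (1/2 :: real) K"
  define P where "P = pochhammer (real p / 2) K"
  define Q where "Q = pochhammer (real q / 2) K"
  define c :: real where "c = (2 ^ (2 * K) - 2) / 2 ^ (2 * K)"
  have h: "h > 0" unfolding h_def by (rule pochhammer_pos) simp
  have Q: "Q > 0" unfolding Q_def using q by (intro pochhammer_pos) simp
  have hP: "h \<le> P" unfolding h_def P_def using p by (intro pochhammer_mono) auto
  have P: "P > 0" using h hP by simp
  have mh: "m * m \<le> h * m"
    using pochhammer_minus_half_le[of k] by (simp add: m_def h_def K_def power2_eq_square)
  have m: "m \<ge> 0"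
    using pochhammer_pos[of "1/2 :: real" k] by (simp add: m_def K_def pochhammer_rec)
  have "(2 :: real) ^ 1 \<le> 2 ^ (2 * K)" by (rule power_increasing) (simp_all add: K_def)
  then have c: "0 \<le> c" "c \<le> 1" by (simp_all add: c_def divide_le_eq)
  have zb: "0 \<le> z K" "z K \<le> Q / h" using z by (simp_all add: K_def Q_def h_def)
  have eq: "dcov_term p q z K = c * (z K * (h * (m * m) / (P * Q * fact K)))"
    unfolding dcov_term_def c_def m_def h_def P_def Q_def by (simp add: field_simps)
  have nn: "0 \<le> h * (m * m) / (P * Q * fact K)" using h P Q by simp
  have "0 \<le> dcov_term p q z K"
    unfolding eq by (intro mult_nonneg_nonneg c zb nn)
  then show "0 \<le> dcov_term p q z (Suc k)" by (simp only: K_def)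
  have "dcov_term p q z K \<le> 1 * (Q / h * (h * (m * m) / (P * Q * fact K)))"
    unfolding eq by (intro mult_mono c zb nn mult_nonneg_nonneg mult_right_mono) simp_all
  also have "\<dots> = m * m / (P * fact K)" using h Q by simp
  also have "\<dots> \<le> P * m / (P * fact K)"
    using mh hP m P by (intro divide_right_mono) (auto intro: order_trans mult_right_mono)
  also have "\<dots> = m / fact K" using P by simp
  finally show "dcov_term p q z (Suc k) \<le> - (pochhammer (-1/2) (Suc k) / fact (Suc k))"
    by (simp add: m_def K_def)
qed

text \<open>
  Conversion from Gamma functions to Pochhammer symbols; the value \<open>Gamma (-1/2) = - 2 * sqrt pi\<close>
  contributes, once for each of the two spaces, to the constant \<open>4 * pi\<close> of the theorem.
\<close>

lemma radial_moment_const_eq: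
  assumes n: "n > 0"
  shows "radial_moment_const n k =
    dcov_const (n - 1) * (- 2 * sqrt pi * pochhammer (-1/2) k) * pochhammer (1/2) k / pochhammer (real n / 2) k"
proof -
  have notin: "(-1/2 :: real) \<notin> \<int>\<^sub>\<le>\<^sub>0"
  proof
    assume "(-1/2 :: real) \<in> \<int>\<^sub>\<le>\<^sub>0"
    then obtain n :: int where "-1/2 = real_of_int n" by (auto elim: nonpos_Ints_cases)
    then have "real_of_int (2 * n) = real_of_int (- 1)" by simp
    then have "2 * n = - 1" by (simp only: of_int_eq_iff)
    then show False by presburger
  qed
  have half: "Gamma (-1/2 :: real) = - 2 * sqrt pi"
    using Gamma_plus1[OF notin] by (simp add: Gamma_one_half_real)
  have "pochhammer (-1/2) k = Gamma (-1/2 + real k) / (- 2 * sqrt pi)"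
    unfolding half[symmetric] by (rule pochhammer_Gamma[OF notin])
  then have G1: "Gamma (real k - 1/2) = - 2 * sqrt pi * pochhammer (-1/2) k"
    by (simp add: field_simps)
  have "real n / 2 \<notin> \<int>\<^sub>\<le>\<^sub>0" using n nonpos_Ints_nonpos[of "real n / 2"] by auto
  moreover have "Gamma (real n / 2) > 0" using n by (intro Gamma_real_pos) simp
  ultimately have G2: "Gamma (real n / 2 + real k) = Gamma (real n / 2) * pochhammer (real n / 2) k"
    by (simp add: pochhammer_Gamma)
  have c: "dcov_const (n - 1) = pi powr (real n / 2) / Gamma (real n / 2)"
    using n by (simp add: dcov_const_def of_nat_diff)
  show ?thesis unfolding radial_moment_const_def G1 G2 c by (simp add: field_simps)
qed

lemma dependence_term_eq:
  assumes "p > 0" "q > 0"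
  shows "(2 ^ (2 * k) - 2) / fact (2 * k) * radial_moment_const p k * radial_moment_const q k * z k =
    4 * pi * dcov_const (p - 1) * dcov_const (q - 1) * dcov_term p q z k"
proof -
  have pos: "pochhammer (1/2 :: real) k > 0" by (rule pochhammer_pos) simp
  \<comment> \<open>One of the two factors \<open>pochhammer (1/2) k\<close> is absorbed by \<open>fact_double\<close>.\<close>
  have regroup: "w / (e * h * f) * (a * (- 2 * r * m) * h / P) * (b * (- 2 * r * m) * h / Q) * y =
      4 * (r * r) * a * b * (w / (f * e) * (h * m * m / (P * Q)) * y)"
    if "h > 0" for w e h f a r m P b Q y :: real
  proof -
    have "w / (e * h * f) * (a * (- 2 * r * m) * h / P) * (b * (- 2 * r * m) * h / Q) * y =
      (h * w / (e * h * f)) * (4 * (r * r) * a * b * (h * m * m / (P * Q)) * y)"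
      by (simp add: divide_inverse mult_ac)
    also have "h * w / (e * h * f) = w / (f * e)" using that by simp
    finally show ?thesis by (simp add: mult_ac)
  qed
  show ?thesis
    unfolding radial_moment_const_eq[OF assms(1)] radial_moment_const_eq[OF assms(2)] dcov_term_def fact_double
    by (subst regroup[OF pos]) simp
qed

lemma dcov_const_pos: "dcov_const n > 0"
  unfolding dcov_const_def by (intro divide_pos_pos Gamma_real_pos) (auto simp: add_nonneg_pos)

theorem theorem3p1:
  fixes M :: "'a measure"
    and X :: "'a \<Rightarrow> real^'p" and Y :: "'a \<Rightarrow> real^'q"
    and \<mu> :: "real^('p + 'q)"
    and \<Sigma>\<^sub>X :: "real^'p^'p" and \<Sigma>\<^sub>X\<^sub>Y :: "real^'q^'p" and \<Sigma>\<^sub>Y :: "real^'q^'q"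
  assumes "prob_space M"
    and "multivariate_normal M (\<lambda>w. join_vec (X w) (Y w)) \<mu>
           (block_matrix \<Sigma>\<^sub>X \<Sigma>\<^sub>X\<^sub>Y (transpose \<Sigma>\<^sub>X\<^sub>Y) \<Sigma>\<^sub>Y)"
    and "invertible \<Sigma>\<^sub>X" and "invertible \<Sigma>\<^sub>Y"
  shows "let p = CARD('p); q = CARD('q);
             \<Lambda> = inv_sqrt \<Sigma>\<^sub>Y ** transpose \<Sigma>\<^sub>X\<^sub>Y ** matrix_inv \<Sigma>\<^sub>X ** \<Sigma>\<^sub>X\<^sub>Y ** inv_sqrt \<Sigma>\<^sub>Y;
             T = (\<lambda>k::nat. (2 ^ (2 * k) - 2) / (fact k * 2 ^ (2 * k)) *
                    (pochhammer (1/2) k * pochhammer (-1/2) k * pochhammer (-1/2) k /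
                      (pochhammer (real p / 2) k * pochhammer (real q / 2) k)) * zonal k \<Lambda>)
         in integrable lborel (dcov_integrand M (standardize M X) (standardize M Y)) \<and>
            summable (\<lambda>k. T (Suc k)) \<and>
            (affine_dcov M X Y)\<^sup>2 =
              4 * pi * (dcov_const (p - 1) / dcov_const p) * (dcov_const (q - 1) / dcov_const q) *
                (\<Sum>k. T (Suc k))"
proof -
  interpret prob_space M by fact
  define A where "A = inv_sqrt \<Sigma>\<^sub>X ** \<Sigma>\<^sub>X\<^sub>Y ** inv_sqrt \<Sigma>\<^sub>Y"
  define \<Lambda> where "\<Lambda> = transpose A ** A"
  let ?f = "dcov_integrand M (standardize M X) (standardize M Y)"
  note std = dcov_integrand_standardized_normal[OF assms(2-4), folded A_def]
  have \<Lambda>: "inv_sqrt \<Sigma>\<^sub>Y ** transpose \<Sigma>\<^sub>X\<^sub>Y ** matrix_inv \<Sigma>\<^sub>X ** \<Sigma>\<^sub>X\<^sub>Y ** inv_sqrt \<Sigma>\<^sub>Y = \<Lambda>"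
    unfolding \<Lambda>_def by (rule std(3))
  have "transpose \<Lambda> = \<Lambda>" by (simp add: \<Lambda>_def matrix_transpose_mul)
  then obtain Q d where Q: "orthogonal_matrix Q" and L: "\<Lambda> = Q ** diagonal_matrix d ** transpose Q"
    by (rule symmetric_matrix_diagonalization)
  have d_eq: "d j = (norm (A *v column j Q))\<^sup>2" for j
  proof -
    have n: "norm (column j Q) = 1" using Q by (simp add: orthogonal_matrix_orthonormal_columns)
    have "column j Q \<bullet> (\<Lambda> *v column j Q) = d j * (column j Q \<bullet> column j Q)"
      unfolding L by (simp only: diagonalized_eigenvector(1)[OF Q] inner_scaleR_right)
    moreover have "column j Q \<bullet> (\<Lambda> *v column j Q) = (norm (A *v column j Q))\<^sup>2"
      unfolding \<Lambda>_def power2_norm_eq_inner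
      by (metis dot_lmul_matrix inner_commute matrix_vector_mul_assoc transpose_matrix_vector)
    ultimately show ?thesis using n by (simp add: norm_eq_1)
  qed
  \<comment> \<open>\<open>A\<close> is a contraction, so the zonal polynomials of \<open>A\<^sup>T A\<close> do not exceed those of the identity.\<close>
  have d: "0 \<le> d j" "d j \<le> 1" for j
  proof -
    have "norm (column j Q) = 1" using Q by (simp add: orthogonal_matrix_orthonormal_columns)
    then have "norm (A *v column j Q) \<le> 1" using std(2)[of "column j Q"] by simp
    then show "0 \<le> d j" "d j \<le> 1" by (simp_all add: d_eq power_le_one)
  qed
  define p where "p = CARD('p)"
  define q where "q = CARD('q)"
  have pq: "p > 0" "q > 0" by (simp_all add: p_def q_def)
  define T where "T = dcov_term p q (\<lambda>k. zonal k \<Lambda>)"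
  have zonal: "0 \<le> zonal k \<Lambda>" "zonal k \<Lambda> \<le> pochhammer (real q / 2) k / pochhammer (1/2) k" for k
    using zonal_nonneg_le[OF Q L d] by (simp_all add: q_def)
  have T: "0 \<le> T (Suc k)" "T (Suc k) \<le> - (pochhammer (-1/2) (Suc k) / fact (Suc k))" for k
    unfolding T_def using dcov_term_bounds[OF pq, of "\<lambda>k. zonal k \<Lambda>" k] zonal[of "Suc k"] by blast+
  have summable: "summable (\<lambda>k. T (Suc k))"
    by (rule summable_comparison_test'[OF summable_pochhammer_minus_half, of 0]) (use T in simp)
  define K where "K = 4 * pi * dcov_const (p - 1) * dcov_const (q - 1)"
  have K: "K \<ge> 0" using dcov_const_pos[of "p - 1"] dcov_const_pos[of "q - 1"] by (simp add: K_def)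
  have nonneg: "0 \<le> ?f z" for z
    unfolding std(1) by (intro mult_nonneg_nonneg) simp_all
  have meas: "?f \<in> borel_measurable lborel"
    unfolding std(1) lborel_prod[symmetric] by measurable
  have "(\<integral>\<^sup>+z. ennreal (?f z) \<partial>lborel) = (\<Sum>k. ennreal (K * T (Suc k)))"
    unfolding std(1) nn_integral_dependence[OF Q L[unfolded \<Lambda>_def] d(1)] \<Lambda>_def[symmetric]
      p_def[symmetric] q_def[symmetric] dependence_term_eq[OF pq, of _ "\<lambda>k. zonal k \<Lambda>"] K_def T_def ..
  also have "\<dots> = ennreal (\<Sum>k. K * T (Suc k))"
    using T K by (intro suminf_ennreal2 mult_nonneg_nonneg summable_mult summable) simp_all
  also have "(\<Sum>k. K * T (Suc k)) = K * (\<Sum>k. T (Suc k))"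
    by (rule suminf_mult[OF summable])
  finally have nn: "(\<integral>\<^sup>+z. ennreal (?f z) \<partial>lborel) = ennreal (K * (\<Sum>k. T (Suc k)))" .
  have sum_nonneg: "0 \<le> (\<Sum>k. T (Suc k))" by (intro suminf_nonneg summable T)
  have int: "integrable lborel ?f"
    by (rule integrableI_nn_integral_finite[OF meas _ nn]) (simp add: nonneg)
  have integral: "(LINT z|lborel. ?f z) = K * (\<Sum>k. T (Suc k))"
    using K sum_nonneg by (intro integral_eq_nn_integral[OF meas, THEN trans]) (simp_all add: nonneg nn)
  have "(affine_dcov M X Y)\<^sup>2 = 1 / (dcov_const p * dcov_const q) * (K * (\<Sum>k. T (Suc k)))"
    unfolding affine_dcov_def dcov_def integral p_def[symmetric] q_def[symmetric]
    using K sum_nonneg dcov_const_pos[of p] dcov_const_pos[of q] by (intro real_sqrt_pow2) simp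
  also have "\<dots> = 4 * pi * (dcov_const (p - 1) / dcov_const p) * (dcov_const (q - 1) / dcov_const q) * (\<Sum>k. T (Suc k))"
    by (simp add: K_def)
  finally show ?thesis
    using int summable unfolding Let_def \<Lambda> p_def[symmetric] q_def[symmetric] T_def dcov_term_def by blast
qed

end
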